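(* Let $\mathcal{T}_0,\dots,\mathcal{T}_5$, the Wang shifts $\Omega_i=\Omega_{\mathcal{T}_i}$, the $2$-dimensional morphisms $\omega_i:\Omega_{i+1}\to\Omega_i$ ($0\le i\le 3$) and the map $\jmath:\Omega_5\to\Omega_4$ be as defined in the context. Let $X_4=\jmath(\Omega_5)$, $X_3=\overline{\omega_3(X_4)}^{\sigma}$, $X_2=\overline{\omega_2(X_3)}^{\sigma}$, $X_1=\overline{\omega_1(X_2)}^{\sigma}$ and $X_0=\overline{\omega_0(X_1)}^{\sigma}$. Then $X_i\subseteq\Omega_i$ is an aperiodic and minimal subshift of $\Omega_i$ for every $i$ with $0\le i\le 4$.
   Context: A Wang tile is a tuple $(a,b,c,d)$ giving the colors of the right, top, left and bottom edges of a unit square, in this order. For a finite set $\mathcal{T}$ of Wang tiles, the Wang shift $\Omega_{\mathcal T}$ is the set of all $x:\mathbb{Z}^2\to\mathcal{T}$ such that for every $\mathbf n$ the right color of $x(\mathbf n)$ equals the left color of $x(\mathbf n+\mathbf e_1)$ and the top color of $x(\mathbf n)$ equals the bottom color of $x(\mathbf n+\mathbf e_2)$. The shift is $(\sigma^{\mathbf n}x)_{\mathbf m}=x_{\mathbf m+\mathbf n}$ and $\overline{Y}^{\sigma}=\bigcup_{\mathbf k\in\mathbb{Z}^2}\sigma^{\mathbf k}(Y)$. A subshift (closed shift-invariant set) is minimal if it contains no nonempty proper closed shift-invariant subset; aperiodic if it is nonempty and no element has a nonzero period. Colors are words over digits; tiles of each set are indexed from $0$. $\mathcal{T}_0$ (the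 Jeandel-Rao tiles, indices 0 to 10): (2,4,2,1), (2,2,2,0), (1,1,3,1), (1,2,3,2), (3,1,3,3), (0,1,3,1), (0,0,0,1), (3,1,0,2), (0,2,1,2), (1,2,1,4), (3,3,1,2). For $i=0,1,2,3$ the set $\mathcal{T}_{i+1}$ is obtained from $\mathcal{T}_i$ and the rule $\omega_i$ below: the tile of index $a$ in $\mathcal{T}_{i+1}$ is the tile $\omega_i(a)$ of $\mathcal{T}_i$ if $\omega_i(a)$ is a single index; if $\omega_i(a)=u|v$ (a vertical domino with tile $u$ below and tile $v$ above), it is the vertical fusion $(YZ,D,XW,A)$ of the tiles $u=(Y,B,X,A)$ and $v=(Z,D,W,B)$ of $\mathcal{T}_i$ (colors are concatenated). Images are listed in the order of the index $a$: $\omega_0$, $a=0..7$: 2, 3, 4, 5, 6, 7, 8, 10; $a=8..12$: 0|9, 1|3, 1|7, 1|8, 1|10. $\omega_1$, $a=0..7$: 0, 1, 2, 3, 4, 5, 6, 7; $a=8..19$: 8|1, 8|5, 8|6, 8|7, 9|1, 9|5, 9|6, 10|0, 10|3, 11|5, 11|7, 12|2. $\omega_2$, $a=0..3$: 2, 3, 4, 5; $a=4..23$: 8|1, 8|5, 8|6, 9|0, 9|3, 10|5, 10|7, 11|2, 12|5, 12|6, 13|4, 14|5, 15|3, 16|3, 16|4, 17|3, 18|2, 19|0, 19|3, 19|4. $\omega_3$, $a=0..12$: 5, 8, 11, 12, 14, 15, 16, 17, 18, 19, 20, 22, 23; $a=13..27$: 4|3, 5|2, 6|3, 7|1, 7|2,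 8|1, 8|2, 9|1, 10|0, 11|2, 12|2, 15|2, 16|2, 20|2, 22|2. In a tiling of $\Omega_{i+1}$ all tiles of a given row have images under $\omega_i$ of the same height; the map $\omega_i:\Omega_{i+1}\to\Omega_i$ sends $x$ to the tiling obtained by juxtaposing the images of its tiles, the bottom tile of $\omega_i(x_{\mathbf 0})$ being placed at position $\mathbf 0$. $\mathcal{T}_5$ (indices 0 to 28): (2113,5,2130,1), (2130,1,2103,5), (2133,1,2113,1), (2113,5,2330,0), (2130,6,2300,0), (2103,5,2310,0), (2310,1,2033,6), (2300,1,2033,6), (2300,0,2030,6), (2030,1,2103,0), (2033,1,2113,0), (2330,1,2133,6), (2330,0,2130,6), (21113,5,21330,1), (21130,6,21300,1), (21103,5,21310,1), (21310,1,21033,5), (21310,0,21030,5), (21300,1,21033,5), (21300,0,21030,5), (21030,1,21103,1), (21033,1,21113,1), (21330,0,21130,1), (21330,0,21130,5), (21130,6,23300,0), (21030,6,23100,0), (23100,0,20330,6), (20330,0,21130,0), (23300,0,21330,6). The map $\jmath:\mathcal{T}_5\to\mathcal{T}_4$ replaces the top and bottom colors $5$ by $1$ and $6$ by $0$ (and leaves all other colors unchanged); $\jmath:\Omega_5\to\Omega_4$ applies it to every tile of a tiling. *)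

theory Defs
  imports "HOL-Analysis.Analysis"
begin

(* A colour is a word over the digits, stored as the list of its digits: 2113 is [2,1,1,3]. *)
type_synonym color = "nat list"

(* Edge colours in the order right, top, left, bottom. *)
type_synonym wang_tile = "color \<times> color \<times> color \<times> color"

type_synonym 'a config = "int \<times> int \<Rightarrow> 'a"

fun right_color :: "wang_tile \<Rightarrow> color" where "right_color (a, b, c, d) = a"
fun top_color :: "wang_tile \<Rightarrow> color" where "top_color (a, b, c, d) = b"
fun left_color :: "wang_tile \<Rightarrow> color" where "left_color (a, b, c, d) = c"
fun bottom_color :: "wang_tile \<Rightarrow> color" where "bottom_color (a, b, c, d) = d"

definition wang_shift :: "wang_tile set \<Rightarrow> wang_tile config set" where
  "wang_shift T = {x. range x \<subseteq> T \<and>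
     (\<forall>n. right_color (x n) = left_color (x (n + (1, 0))) \<and>
          top_color (x n) = bottom_color (x (n + (0, 1))))}"

definition shift :: "int \<times> int \<Rightarrow> 'a config \<Rightarrow> 'a config" where
  "shift n x = (\<lambda>m. x (m + n))"

(* The closure under shifts; no topological closure is taken. *)
definition shift_closure :: "'a config set \<Rightarrow> 'a config set" where
  "shift_closure Y = (\<Union>k. shift k ` Y)"

definition subshift :: "'a set \<Rightarrow> 'a config set \<Rightarrow> bool" where
  "subshift A X \<longleftrightarrow>
     closedin (product_topology (\<lambda>_. discrete_topology A) UNIV) X \<and> (\<forall>n. shift n ` X = X)"

definition minimal_subshift :: "'a set \<Rightarrow> 'a config set \<Rightarrow> bool" where
  "minimal_subshift A X \<longleftrightarrow>
     subshift A X \<and> (\<forall>Y. Y \<subseteq> X \<and> Y \<noteq> {} \<and> subshift A Y \<longrightarrow> Y = X)"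

definition aperiodic :: "'a config set \<Rightarrow> bool" where
  "aperiodic X \<longleftrightarrow> X \<noteq> {} \<and> (\<forall>x\<in>X. \<forall>n. n \<noteq> 0 \<longrightarrow> shift n x \<noteq> x)"

(* The first tile is the lower one. *)
fun vertical_fusion :: "wang_tile \<Rightarrow> wang_tile \<Rightarrow> wang_tile" where
  "vertical_fusion (Y, B, X, A) (Z, D, W, B') = (Y @ Z, D, X @ W, A)"

(* Images are vertical words of tile indices written from bottom to top:
   [a] is a single tile and [u, v] is the domino u|v. *)
fun fuse :: "wang_tile list \<Rightarrow> wang_tile" where
  "fuse [t] = t"
| "fuse (u # v # w) = vertical_fusion u (fuse (v # w))"

definition derived_tiles :: "wang_tile list \<Rightarrow> nat list list \<Rightarrow> wang_tile list" where
  "derived_tiles T r = map (\<lambda>w. fuse (map ((!) T) w)) r"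

definition T0 :: "wang_tile list" where
  "T0 =
   [([2], [4], [2], [1]),
    ([2], [2], [2], [0]),
    ([1], [1], [3], [1]),
    ([1], [2], [3], [2]),
    ([3], [1], [3], [3]),
    ([0], [1], [3], [1]),
    ([0], [0], [0], [1]),
    ([3], [1], [0], [2]),
    ([0], [2], [1], [2]),
    ([1], [2], [1], [4]),
    ([3], [3], [1], [2])]"

definition rule0 :: "nat list list" where
  "rule0 =
   [[2], [3], [4], [5], [6], [7], [8], [10], [0,9], [1,3], [1,7], [1,8], [1,10]]"

definition rule1 :: "nat list list" where
  "rule1 =
   [[0], [1], [2], [3], [4], [5], [6], [7], [8,1], [8,5], [8,6], [8,7], [9,1],
    [9,5], [9,6], [10,0], [10,3], [11,5], [11,7], [12,2]]"

definition rule2 :: "nat list list" where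
  "rule2 =
   [[2], [3], [4], [5], [8,1], [8,5], [8,6], [9,0], [9,3], [10,5], [10,7], [11,2],
    [12,5], [12,6], [13,4], [14,5], [15,3], [16,3], [16,4], [17,3], [18,2], [19,0],
    [19,3], [19,4]]"

definition rule3 :: "nat list list" where
  "rule3 =
   [[5], [8], [11], [12], [14], [15], [16], [17], [18], [19], [20], [22], [23],
    [4,3], [5,2], [6,3], [7,1], [7,2], [8,1], [8,2], [9,1], [10,0], [11,2], [12,2],
    [15,2], [16,2], [20,2], [22,2]]"

definition "T1 = derived_tiles T0 rule0"
definition "T2 = derived_tiles T1 rule1"
definition "T3 = derived_tiles T2 rule2"
definition "T4 = derived_tiles T3 rule3"

definition T5 :: "wang_tile list" where
  "T5 =
   [([2,1,1,3], [5], [2,1,3,0], [1]),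
    ([2,1,3,0], [1], [2,1,0,3], [5]),
    ([2,1,3,3], [1], [2,1,1,3], [1]),
    ([2,1,1,3], [5], [2,3,3,0], [0]),
    ([2,1,3,0], [6], [2,3,0,0], [0]),
    ([2,1,0,3], [5], [2,3,1,0], [0]),
    ([2,3,1,0], [1], [2,0,3,3], [6]),
    ([2,3,0,0], [1], [2,0,3,3], [6]),
    ([2,3,0,0], [0], [2,0,3,0], [6]),
    ([2,0,3,0], [1], [2,1,0,3], [0]),
    ([2,0,3,3], [1], [2,1,1,3], [0]),
    ([2,3,3,0], [1], [2,1,3,3], [6]),
    ([2,3,3,0], [0], [2,1,3,0], [6]),
    ([2,1,1,1,3], [5], [2,1,3,3,0], [1]),
    ([2,1,1,3,0], [6], [2,1,3,0,0], [1]),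
    ([2,1,1,0,3], [5], [2,1,3,1,0], [1]),
    ([2,1,3,1,0], [1], [2,1,0,3,3], [5]),
    ([2,1,3,1,0], [0], [2,1,0,3,0], [5]),
    ([2,1,3,0,0], [1], [2,1,0,3,3], [5]),
    ([2,1,3,0,0], [0], [2,1,0,3,0], [5]),
    ([2,1,0,3,0], [1], [2,1,1,0,3], [1]),
    ([2,1,0,3,3], [1], [2,1,1,1,3], [1]),
    ([2,1,3,3,0], [0], [2,1,1,3,0], [1]),
    ([2,1,3,3,0], [0], [2,1,1,3,0], [5]),
    ([2,1,1,3,0], [6], [2,3,3,0,0], [0]),
    ([2,1,0,3,0], [6], [2,3,1,0,0], [0]),
    ([2,3,1,0,0], [0], [2,0,3,3,0], [6]),
    ([2,0,3,3,0], [0], [2,1,1,3,0], [0]),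
    ([2,3,3,0,0], [0], [2,1,3,3,0], [6])]"

(* tiles is meant for i \<le> 5 and rule for i < 4. *)
definition tiles :: "nat \<Rightarrow> wang_tile list" where
  "tiles i = [T0, T1, T2, T3, T4, T5] ! i"

definition rule :: "nat \<Rightarrow> nat list list" where
  "rule i = [rule0, rule1, rule2, rule3] ! i"

definition Omega :: "nat \<Rightarrow> wang_tile config set" where
  "Omega i = wang_shift (set (tiles i))"

(* The image of a tile of tiles (Suc i), as a column of tiles of tiles i from bottom to top.
   The lookup by tile recovers the index, since each of these lists is distinct. *)
definition tile_image :: "nat \<Rightarrow> wang_tile \<Rightarrow> wang_tile list" where
  "tile_image i t =
     the (map_of (zip (tiles (Suc i)) (map (map ((!) (tiles i))) (rule i))) t)"

(* Height at which the image of the tile at (m, k) starts when the columns f (x (m, j)) are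
   stacked with the image of x (m, 0) starting at height 0. One of the two sums is empty. *)
definition base_height :: "('a \<Rightarrow> 'b list) \<Rightarrow> 'a config \<Rightarrow> int \<Rightarrow> int \<Rightarrow> int" where
  "base_height f x m k =
     (\<Sum>j\<in>{0..<k}. int (length (f (x (m, j))))) - (\<Sum>j\<in>{k..<0}. int (length (f (x (m, j)))))"

(* Heights are accumulated in each column separately. For f = tile_image i on Omega (Suc i) with
   i < 4 this is the usual juxtaposition because images of tiles in one row have equal height (lemma row_height). *)
definition juxtapose :: "('a \<Rightarrow> 'b list) \<Rightarrow> 'a config \<Rightarrow> 'b config" where
  "juxtapose f x = (\<lambda>(m, n).
     let k = (THE k. base_height f x m k \<le> n \<and> n < base_height f x m (k + 1))
     in f (x (m, k)) ! nat (n - base_height f x m k))"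

definition omega :: "nat \<Rightarrow> wang_tile config \<Rightarrow> wang_tile config" where
  "omega i = juxtapose (tile_image i)"

definition recolor :: "color \<Rightarrow> color" where
  "recolor c = (if c = [5] then [1] else if c = [6] then [0] else c)"

fun jmath_tile :: "wang_tile \<Rightarrow> wang_tile" where
  "jmath_tile (a, b, c, d) = (a, recolor b, c, recolor d)"

definition jmath :: "wang_tile config \<Rightarrow> wang_tile config" where
  "jmath x = jmath_tile \<circ> x"

lemma distinct_tiles: "\<forall>i\<in>{0,1,2,3,4,5}. distinct (tiles i)"
  by code_simp

lemma jmath_tile_image: "jmath_tile ` set (tiles 5) = set (tiles 4)"
  by code_simp

lemma length_rule: "\<forall>i\<in>{0,1,2,3}. length (rule i) = length (tiles (Suc i))"
  by code_simp

lemma rule_height: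
  "\<forall>i\<in>{0,1,2,3}. \<forall>(t, w)\<in>set (zip (tiles (Suc i)) (rule i)).
     length (left_color t) = length (right_color t) \<and>
     length w = (if length (left_color t) = [1, 1, 1, 4] ! i then 1 else 2)"
  by code_simp

lemma tile_image_height:
  assumes i: "i \<in> {0,1,2,3}" and t: "t \<in> set (tiles (Suc i))"
  shows "length (left_color t) = length (right_color t) \<and>
     length (tile_image i t) = (if length (left_color t) = [1, 1, 1, 4] ! i then 1 else 2)"
proof -
  let ?g = "map ((!) (tiles i))"
  have len: "length (tiles (Suc i)) = length (map ?g (rule i))"
    using length_rule i by (metis length_map)
  then obtain v where v: "map_of (zip (tiles (Suc i)) (map ?g (rule i))) t = Some v"
    using t by (metis map_of_zip_is_Some)
  then have "(t, v) \<in> set (zip (tiles (Suc i)) (map ?g (rule i)))"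
    by (rule map_of_SomeD)
  then obtain w where w: "(t, w) \<in> set (zip (tiles (Suc i)) (rule i))" "v = ?g w"
    by (auto simp: zip_map2)
  have "length (tile_image i t) = length w"
    using v w(2) by (simp add: tile_image_def)
  then show ?thesis
    using bspec[OF bspec[OF rule_height i], OF w(1)] by simp
qed

lemma row_height:
  assumes "i < 4" and x: "x \<in> Omega (Suc i)"
  shows "length (tile_image i (x (m, k))) = length (tile_image i (x (0, k)))"
proof -
  have i: "i \<in> {0,1,2,3}"
    using assms(1) by auto
  have step: "length (tile_image i (x (m, k))) = length (tile_image i (x (m + 1, k)))" for m
  proof -
    have "x n \<in> set (tiles (Suc i))" for n
      using x by (auto simp: Omega_def wang_shift_def)
    then have "length (left_color (x n)) = length (right_color (x n)) \<and>
        length (tile_image i (x n)) = (if length (left_color (x n)) = [1, 1, 1, 4] ! i then 1 else 2)" for n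
      using tile_image_height[OF i] by blast
    moreover have "right_color (x (m, k)) = left_color (x ((m, k) + (1, 0)))"
      using x unfolding Omega_def wang_shift_def by blast
    ultimately show ?thesis
      by (metis add_Pair add_0_right)
  qed
  show ?thesis
  proof (induction m rule: int_induct[where k = 0])
    case base
    show ?case ..
  next
    case (step1 m)
    then show ?case using step[of m] by simp
  next
    case (step2 m)
    then show ?case using step[of "m - 1"] by simp
  qed
qed

end

theory Submission
  imports Defs
begin

text \<open>
  Everything reduces to the Wang shift of \<open>T5\<close>. Reading a tiling along the diagonals \<open>(m + n, n)\<close> makes its
  columns fall into three types, and cutting before every column of one type gives words which are the
  letters of a new system A. Cutting the rows of A gives a system C, and cutting the columns of C gives A
  again. So C is self-similar: each of its configurations is sliced into blocks of width and height at
  least 2 which are the images of the letters of another configuration of C, and the slicing is unique.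

  A period of a configuration pulls back along a slicing to a period at most half as long, so no
  configuration has a nonzero period. A window of size \<open>l > 2\<close> is covered by the image of a window of size
  \<open>l - 1\<close>, so all windows of one configuration occur in every other one as soon as this holds for the
  2 by 2 blocks, and there it is a finite reachability check. By compactness C is nonempty, since images
  of a legal block are legal. For the other two properties the lists of legal blocks may be too large: it
  suffices that every legal configuration is sliced by a legal configuration of the next system.

  Repetitivity, aperiodicity and closedness then pass from \<open>T5\<close> to the recoloured system and through the four
  juxtapositions, where tiles that occur only as one fixed half of a domino make the slicing unique.
\<close>

text \<open>The plane substitutions are never handled as such. Each of them is factored into a
  cutting along rows and a cutting along columns, so every lemma on slicings is one-dimensional with
  the other coordinate as a parameter, and transposition supplies the second direction.

  Legality is stated for 2 by 2 blocks because this size is stable: a 2 by 2 window of an image lies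
  in the image of a 2 by 2 block. Words of length 2 cannot shrink such a window any further, so
  these blocks and not single letters are the base case of the descent.

  The tables have to serve two opposite purposes. Desubstitution wants lists that contain whatever
  occurs, inflation wants lists that are closed under taking images. Hence the lists found by the
  search are first thinned out by ranks. Even then a listed block need not occur in any
  configuration, and repetitivity has to deal with this.\<close>

definition transposed :: "'a config \<Rightarrow> 'a config" where
  "transposed x = (\<lambda>(m, n). x (n, m))"

text \<open>The letter \<open>y (i, n)\<close> stands for the horizontal word of \<open>x\<close> in row \<open>n\<close> between \<open>c i\<close> and \<open>c (i + 1)\<close>.
  Slicings along rows are expressed by transposing both configurations.\<close>

definition slicing :: "('b \<Rightarrow> 'a list) \<Rightarrow> 'a config \<Rightarrow> 'b config \<Rightarrow> (int \<Rightarrow> int) \<Rightarrow> bool" where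
  "slicing w x y c \<longleftrightarrow> (\<forall>i n. w (y (i, n)) \<noteq> [] \<and> c (i + 1) = c i + int (length (w (y (i, n)))) \<and>
     (\<forall>s<length (w (y (i, n))). x (c i + int s, n) = w (y (i, n)) ! s))"

definition occurs :: "int \<Rightarrow> int \<Rightarrow> 'a config \<Rightarrow> 'a config \<Rightarrow> bool" where
  "occurs l h x x' \<longleftrightarrow> (\<forall>a b. \<exists>a' b'. \<forall>s\<in>{0..<l}. \<forall>t\<in>{0..<h}. x (a + s, b + t) = x' (a' + s, b' + t))"

text \<open>All that is kept of the uniqueness of a slicing: a period of \<open>x\<close> maps cuts
  to cuts, hence shifts their indices by a constant \<open>q\<close> and induces a period of
  \<open>y\<close>. In this form periods descend.\<close>

definition recognizable :: "'a config \<Rightarrow> 'b config \<Rightarrow> (int \<Rightarrow> int) \<Rightarrow> bool" where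
  "recognizable x y c \<longleftrightarrow> (\<forall>p. shift p x = x \<longrightarrow>
     (\<exists>q. (\<forall>i. c (i + q) = c i + fst p) \<and> shift (q, snd p) y = y))"

lemma transposed_apply [simp]: "transposed x (m, n) = x (n, m)"
  by (simp add: transposed_def)

lemma transposed_transposed [simp]: "transposed (transposed x) = x"
  by (auto simp: transposed_def)

lemma shift_shift: "shift p (shift q x) = shift (p + q) x"
  by (simp add: shift_def add.assoc)

lemma shift_0 [simp]: "shift 0 x = x" "shift (0, 0) x = x"
  by (simp_all add: shift_def flip: zero_prod_def)

lemma shift_transposed: "shift (p, q) (transposed x) = transposed (shift (q, p) x)"
  by (auto simp: shift_def transposed_def)

section \<open>Integer grids\<close>

lemma grid_le:
  fixes c :: "int \<Rightarrow> int"
  assumes step: "\<And>i. c i + d \<le> c (i + 1)" and "i \<le> j"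
  shows "c i + d * (j - i) \<le> c j"
  using assms(2)
proof (induction j rule: int_ge_induct)
  case base then show ?case by simp
next
  case (step j) then show ?case using assms(1)[of j] by (simp add: algebra_simps)
qed

text \<open>Growth by at least 1 per step bounds the indices \<open>i\<close> with
  \<open>c i \<le> m\<close> from above. Counting down from that bound, the first such index is the
  wanted one.\<close>

lemma grid_cell:
  fixes c :: "int \<Rightarrow> int"
  assumes step: "\<And>i. c i < c (i + 1)"
  obtains i where "c i \<le> m" "m < c (i + 1)"
proof -
  have s: "\<And>i. c i + 1 \<le> c (i + 1)" using step by (simp add: add1_zle_eq)
  define S where "S = {i. c i \<le> m}"
  have lo: "c (- \<bar>c 0\<bar> - \<bar>m\<bar>) \<le> m"
    using grid_le[of c 1 "- \<bar>c 0\<bar> - \<bar>m\<bar>" 0] s by (simp; linarith)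
  have hi: "i \<le> \<bar>m\<bar> + \<bar>c 0\<bar>" if "c i \<le> m" for i
  proof (rule ccontr)
    assume "\<not> ?thesis"
    then show False using grid_le[of c 1 0 i] s that by (simp; linarith)
  qed
  obtain j where j: "c (\<bar>m\<bar> + \<bar>c 0\<bar> - int j) \<le> m" "\<And>j'. j' < j \<Longrightarrow> \<not> c (\<bar>m\<bar> + \<bar>c 0\<bar> - int j') \<le> m"
  proof -
    have "\<exists>j. c (\<bar>m\<bar> + \<bar>c 0\<bar> - int j) \<le> m"
      using lo by (intro exI[of _ "nat (2 * (\<bar>m\<bar> + \<bar>c 0\<bar>))"]) (simp add: add.commute[of "\<bar>m\<bar>"])
    then show ?thesis using that exists_least_iff[of "\<lambda>j. c (\<bar>m\<bar> + \<bar>c 0\<bar> - int j) \<le> m"] by blast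
  qed
  have "m < c (\<bar>m\<bar> + \<bar>c 0\<bar> - int j + 1)"
  proof (cases j)
    case 0 then show ?thesis using hi[of "\<bar>m\<bar> + \<bar>c 0\<bar> + 1"] by force
  next
    case (Suc j') then show ?thesis using j(2)[of j'] by (simp add: algebra_simps)
  qed
  then show ?thesis using that j(1) by blast
qed

lemma grid_mono:
  fixes c :: "int \<Rightarrow> int"
  assumes step: "\<And>i. c i < c (i + 1)"
  shows "strict_mono c"
proof (rule strict_monoI)
  fix i j :: int assume "i < j"
  then show "c i < c j"
    using grid_le[where c = c and d = 1, of i j] step by (simp add: add1_zle_eq)
qed

lemma grid_unique:
  fixes c :: "int \<Rightarrow> int"
  assumes "\<And>i. c i < c (i + 1)" "c i \<le> m" "m < c (i + 1)" "c j \<le> m" "m < c (j + 1)"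
  shows "i = j"
proof -
  have "c i < c (j + 1)" "c j < c (i + 1)" using assms(2-) by linarith+
  then have "i < j + 1" "j < i + 1" using strict_mono_less[OF grid_mono[of c]] assms(1) by blast+
  then show ?thesis by simp
qed

text \<open>The set is enumerated outward from its first element above 0. Nothing is skipped: an
  element lies in some cell, and the interior of a cell contains none.\<close>

lemma grid_extend:
  fixes P :: "int \<Rightarrow> bool"
  assumes up: "\<And>m. \<exists>k>m. P k" and down: "\<And>m. \<exists>k<m. P k"
  shows "\<exists>c :: int \<Rightarrow> int. (\<forall>i. c i < c (i + 1)) \<and> (\<forall>m. P m \<longleftrightarrow> m \<in> range c)"
proof -
  define next' where "next' m = m + 1 + int (LEAST j. P (m + 1 + int j))" for m
  define prev where "prev m = m - 1 - int (LEAST j. P (m - 1 - int j))" for m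
  have nx: "P (next' m) \<and> m < next' m \<and> (\<forall>k. m < k \<and> k < next' m \<longrightarrow> \<not> P k)" for m
  proof -
    obtain k where k: "k > m" "P k" using up by blast
    have "P (m + 1 + int (nat (k - m - 1)))" using k by simp
    then have 1: "P (next' m)" unfolding next'_def by (rule LeastI)
    have "\<not> P k" if "m < k" "k < next' m" for k
    proof -
      have "nat (k - m - 1) < (LEAST j. P (m + 1 + int j))" using that by (simp add: next'_def)
      from not_less_Least[OF this] that show ?thesis by simp
    qed
    moreover have "m < next' m" by (simp add: next'_def)
    ultimately show ?thesis using 1 by blast
  qed
  have pv: "P (prev m) \<and> prev m < m \<and> (\<forall>k. prev m < k \<and> k < m \<longrightarrow> \<not> P k)" for m
  proof -
    obtain k where k: "k < m" "P k" using down by blast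
    have "P (m - 1 - int (nat (m - 1 - k)))" using k by simp
    then have 1: "P (prev m)" unfolding prev_def by (rule LeastI)
    have "\<not> P k" if "prev m < k" "k < m" for k
    proof -
      have "nat (m - 1 - k) < (LEAST j. P (m - 1 - int j))" using that by (simp add: prev_def)
      from not_less_Least[OF this] that show ?thesis by simp
    qed
    moreover have "prev m < m" by (simp add: prev_def)
    ultimately show ?thesis using 1 by blast
  qed
  define p where "p = next' 0"
  have p: "P p" using nx by (simp add: p_def)
  define c where "c i = (if 0 \<le> i then (next' ^^ nat i) p else (prev ^^ nat (- i)) p)" for i
  have "P ((next' ^^ k) p)" "P ((prev ^^ k) p)" for k using p nx pv by (induction k) auto
  then have Pc: "P (c i)" for i by (simp add: c_def)
  have c: "c i < c (i + 1) \<and> (\<forall>k. c i < k \<and> k < c (i + 1) \<longrightarrow> \<not> P k)" for i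
  proof (cases "0 \<le> i")
    case True
    then have "c (i + 1) = next' (c i)" by (simp add: c_def nat_add_distrib)
    then show ?thesis using nx by simp
  next
    case False
    then have "nat (- i) = Suc (nat (- (i + 1)))" by simp
    then have "c i = prev (c (i + 1))" using False by (simp add: c_def)
    then show ?thesis using pv by simp
  qed
  have "m \<in> range c" if "P m" for m
  proof -
    obtain i where "c i \<le> m" "m < c (i + 1)" using grid_cell[of c m] c by blast
    then show ?thesis using c[of i] that by (metis order.not_eq_order_implies_strict rangeI)
  qed
  then show ?thesis using c Pc by (intro exI[of _ c]) auto
qed

section \<open>Slicings\<close>

lemma slicingD:
  assumes "slicing w x y c"
  shows "c i < c (i + 1)" and "c (i + 1) = c i + int (length (w (y (i, n))))"
    and "s < length (w (y (i, n))) \<Longrightarrow> x (c i + int s, n) = w (y (i, n)) ! s"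
proof -
  have *: "w (y (i, n)) \<noteq> []" "c (i + 1) = c i + int (length (w (y (i, n))))" for n
    using assms unfolding slicing_def by blast+
  then show "c (i + 1) = c i + int (length (w (y (i, n))))" by blast
  show "c i < c (i + 1)" using *[of 0] by simp
  show "s < length (w (y (i, n))) \<Longrightarrow> x (c i + int s, n) = w (y (i, n)) ! s"
    using assms unfolding slicing_def by blast
qed

lemma slicing_at:
  assumes "slicing w x y c" "c i \<le> m" "m < c (i + 1)"
  shows "x (m, n) = w (y (i, n)) ! nat (m - c i)" "nat (m - c i) < length (w (y (i, n)))"
proof -
  show 1: "nat (m - c i) < length (w (y (i, n)))"
    using assms slicingD(2)[OF assms(1), of i n] by simp
  show "x (m, n) = w (y (i, n)) ! nat (m - c i)"
    using slicingD(3)[OF assms(1) 1] assms(2) by simp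
qed

lemma slicing_step:
  assumes "slicing w x y c" "\<And>n i. d \<le> int (length (w (y (i, n))))"
  shows "c i + d \<le> c (i + 1)"
  using slicingD(2)[OF assms(1), of i 0] assms(2)[of i 0] by simp

text \<open>The \<open>k\<close> letters that cover the window recur in \<open>y'\<close>. Equal
  letters have words of equal length, so the cuts of the copy are a translate of the original ones,
  and the window reappears at the same distance \<open>a - c i\<close> from the left cut. The height
  stays \<open>h\<close> because only one direction is cut.\<close>

lemma occurs_slicing:
  assumes x: "slicing w x y c" and x': "slicing w x' y' c'" and "occurs k h y y'"
    and cover: "\<And>a. \<exists>i. c i \<le> a \<and> a + l \<le> c (i + k)"
  shows "occurs l h x x'"
  unfolding occurs_def
proof (intro allI)
  fix a b
  obtain i where i: "c i \<le> a" "a + l \<le> c (i + k)" using cover by blast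
  obtain i' b' where eq: "\<And>s t. 0 \<le> s \<Longrightarrow> s < k \<Longrightarrow> 0 \<le> t \<Longrightarrow> t < h \<Longrightarrow> y (i + s, b + t) = y' (i' + s, b' + t)"
    using assms(3) unfolding occurs_def by (meson atLeastLessThan_iff)
  have "x (a + s, b + t) = x' (c' i' + (a - c i) + s, b' + t)" if "0 \<le> s" "s < l" "0 \<le> t" "t < h" for s t
  proof -
    have len: "int j \<le> k \<Longrightarrow> c (i + int j) - c i = c' (i' + int j) - c' i'" for j
    proof (induction j)
      case (Suc j)
      have "y (i + int j, b + t) = y' (i' + int j, b' + t)" using eq[of "int j" t] Suc.prems that by simp
      then show ?case
        using Suc slicingD(2)[OF x, of "i + int j" "b + t"] slicingD(2)[OF x', of "i' + int j" "b' + t"]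
        by (simp add: algebra_simps)
    qed simp
    obtain j where j: "c j \<le> a + s" "a + s < c (j + 1)" using grid_cell[of c "a + s"] slicingD(1)[OF x] by blast
    have sm: "strict_mono c" using grid_mono slicingD(1)[OF x] by blast
    have "c i < c (j + 1)" "c j < c (i + k)" using i j that by linarith+
    then have ij: "i \<le> j" "j < i + k" using strict_mono_less[OF sm] by auto
    define u where "u = nat (j - i)"
    have j': "j = i + int u" "int u < k" using ij by (simp_all add: u_def)
    have yy: "y (j, b + t) = y' (i' + int u, b' + t)" using eq[of "int u" t] j' that by simp
    have l1: "c j - c i = c' (i' + int u) - c' i'" using len[of u] j' by simp
    have l2: "c (j + 1) - c j = c' (i' + int u + 1) - c' (i' + int u)"
      using slicingD(2)[OF x, of j "b + t"] slicingD(2)[OF x', of "i' + int u" "b' + t"] yy by simp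
    have "x (a + s, b + t) = w (y (j, b + t)) ! nat (a + s - c j)" using slicing_at[OF x j] by blast
    also have "\<dots> = x' (c' i' + (a - c i) + s, b' + t)"
      using slicing_at(1)[OF x', of "i' + int u" "c' i' + (a - c i) + s" "b' + t"] j l1 l2 yy
      by (smt (verit))
    finally show ?thesis .
  qed
  then show "\<exists>a' b'. \<forall>s\<in>{0..<l}. \<forall>t\<in>{0..<h}. x (a + s, b + t) = x' (a' + s, b' + t)"
    by (intro exI[of _ "c' i' + (a - c i)"] exI[of _ b']) (simp add: add.assoc)
qed

text \<open>Cells have width at least 1, so the cell that contains \<open>a\<close> and the next
  \<open>l - 1\<close> cells reach the end of the window.\<close>

lemma slicing_cover:
  assumes "slicing w x y c" "0 < l"
  shows "\<exists>i. c i \<le> a \<and> a + l \<le> c (i + l)"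
proof -
  have s: "\<And>i. c i < c (i + 1)" using slicingD(1)[OF assms(1)] .
  obtain i where i: "c i \<le> a" "a < c (i + 1)" using grid_cell[of c a] s by blast
  have "c (i + 1) + 1 * (i + l - (i + 1)) \<le> c (i + l)"
    by (rule grid_le) (use s assms(2) in \<open>auto simp: add1_zle_eq\<close>)
  then show ?thesis using i by (intro exI[of _ i]) simp
qed

text \<open>The first cell contributes at least one column of the window and the other
  \<open>l - 2\<close> cells at least two each. The total \<open>2 * l - 3\<close> is at least
  \<open>l\<close> exactly from \<open>l = 3\<close> on, so windows of size 2 do not shrink.\<close>

lemma slicing_cover2:
  assumes x: "slicing w x y c" and two: "\<And>n i. 2 \<le> length (w (y (i, n)))" and "3 \<le> l"
  shows "\<exists>i. c i \<le> a \<and> a + l \<le> c (i + (l - 1))"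
proof -
  have s: "\<And>i. c i < c (i + 1)" using slicingD(1)[OF x] .
  obtain i where i: "c i \<le> a" "a < c (i + 1)" using grid_cell[of c a] s by blast
  have "c (i + 1) + 2 * (i + (l - 1) - (i + 1)) \<le> c (i + (l - 1))"
    by (rule grid_le, rule slicing_step[OF x]) (use two assms(3) in \<open>auto simp: numeral_le_iff\<close>)
  then show ?thesis using i assms(3) by (intro exI[of _ i]) simp
qed

lemma occurs_transposed: "occurs l h (transposed x) (transposed x') \<longleftrightarrow> occurs h l x x'"
  unfolding occurs_def by simp blast

lemma occurs_mono: "occurs l h x x' \<Longrightarrow> l' \<le> l \<Longrightarrow> h' \<le> h \<Longrightarrow> occurs l' h' x x'"
  unfolding occurs_def by (meson atLeastLessThan_iff order_less_le_trans)

lemma slicing_recognizable: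
  assumes x: "slicing w x y c" and inj: "inj_on w (range y)"
    and D: "\<And>m n. D (x (m - 1, n)) (x (m, n)) \<longleftrightarrow> m \<in> range c"
  shows "recognizable x y c"
  unfolding recognizable_def
proof (intro allI impI)
  fix p :: "int \<times> int" assume per: "shift p x = x"
  obtain p1 p2 where p: "p = (p1, p2)" by (cases p)
  have xp: "x (m + p1, n + p2) = x (m, n)" for m n
    using fun_cong[OF per, of "(m, n)"] by (simp add: shift_def p)
  have R: "m + p1 \<in> range c \<longleftrightarrow> m \<in> range c" for m
    using D[of "m + p1" p2] D[of m 0] xp[of m 0] xp[of "m - 1" 0] by (simp add: algebra_simps)
  have s: "\<And>i. c i < c (i + 1)" using slicingD(1)[OF x] .
  have sm: "strict_mono c" using grid_mono s by blast
  obtain q where q: "c 0 + p1 = c q" using R[of "c 0"] by auto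
  have nxt: "c (i + 1) \<le> c k" if "c i < c k" for i k
    using that strict_mono_less[OF sm] strict_mono_less_eq[OF sm] by simp
  \<comment> \<open>Translation by \<open>p1\<close> preserves the order and the set of cuts, so
    neighbouring cuts go to neighbouring cuts. The equivalence lets the induction run over all
    integers.\<close>
  have ind: "c (i + q) = c i + p1 \<longleftrightarrow> c (i + 1 + q) = c (i + 1) + p1" for i
  proof
    assume a: "c (i + q) = c i + p1"
    obtain k where k: "c (i + 1) + p1 = c k" using R[of "c (i + 1)"] by auto
    obtain k' where k': "c (i + q + 1) - p1 = c k'" using R[of "c (i + q + 1) - p1"] by auto
    have "c (i + q + 1) \<le> c k" using nxt[of "i + q" k] a k s[of i] by simp
    moreover have "c (i + 1) \<le> c k'" using nxt[of i k'] a k' s[of "i + q"] by simp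
    ultimately show "c (i + 1 + q) = c (i + 1) + p1" using k k' by (simp add: algebra_simps)
  next
    assume a: "c (i + 1 + q) = c (i + 1) + p1"
    obtain k where k: "c i + p1 = c k" using R[of "c i"] by auto
    obtain k' where k': "c (i + q) - p1 = c k'" using R[of "c (i + q) - p1"] by auto
    have "c k < c (i + q + 1)" using a k s[of i] by (simp add: algebra_simps)
    then have "c k \<le> c (i + q)" using nxt[of "i + q" k] by fastforce
    moreover have "c k' < c (i + 1)" using a k' s[of "i + q"] by (simp add: algebra_simps)
    then have "c k' \<le> c i" using nxt[of i k'] by fastforce
    ultimately show "c (i + q) = c i + p1" using k k' by linarith
  qed
  have cq: "c (i + q) = c i + p1" for i
  proof (induction i rule: int_induct[where k = 0])
    case base then show ?case using q by simp
  next
    case (step1 i) then show ?case using ind[of i] by simp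
  next
    case (step2 i) then show ?case using ind[of "i - 1"] by simp
  qed
  have "y (i + q, n + p2) = y (i, n)" for i n
  proof -
    have len: "length (w (y (i + q, n + p2))) = length (w (y (i, n)))"
      using slicingD(2)[OF x, of i n] slicingD(2)[OF x, of "i + q" "n + p2"] cq[of i] cq[of "i + 1"]
      by (simp add: algebra_simps)
    have "w (y (i + q, n + p2)) = w (y (i, n))"
    proof (rule nth_equalityI)
      fix s assume "s < length (w (y (i + q, n + p2)))"
      then show "w (y (i + q, n + p2)) ! s = w (y (i, n)) ! s"
        using slicingD(3)[OF x, of s i n] slicingD(3)[OF x, of s "i + q" "n + p2"] len cq[of i] xp[of "c i + int s" n]
        by (simp add: algebra_simps)
    qed (fact len)
    then show ?thesis using inj by (auto dest: inj_onD)
  qed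
  then have "shift (q, p2) y = y" by (auto simp: shift_def)
  then show "\<exists>q. (\<forall>i. c (i + q) = c i + fst p) \<and> shift (q, snd p) y = y" using cq p by auto
qed

lemma slicing_shift:
  assumes "slicing w x y c"
  shows "slicing w (shift (k, l) x) (shift (0, l) y) (\<lambda>i. c i - k)"
  using assms unfolding slicing_def shift_def by (simp add: algebra_simps)

text \<open>By \<open>len\<close> the heights of a row agree in all columns, so the cuts computed in
  column 0 serve for every column. Images are stacked vertically, hence the transposition.\<close>

lemma juxtapose_slicing:
  assumes len: "\<And>m k. length (f (y (m, k))) = length (f (y (0, k)))" and ne: "\<And>m k. f (y (m, k)) \<noteq> []"
  shows "slicing f (transposed (juxtapose f y)) (transposed y) (base_height f y 0)"
proof -
  define c where "c = base_height f y 0"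
  have bh: "base_height f y m k = c k" for m k
    unfolding c_def base_height_def
    by (intro arg_cong2[where f = "(-)"] sum.cong refl) (use len[of m] in presburger)+
  have c: "c (k + 1) = c k + int (length (f (y (m, k))))" for m k
  proof -
    have "c (k + 1) = c k + int (length (f (y (0, k))))"
    proof (cases "0 \<le> k")
      case True
      then have "{0..<k + 1} = insert k {0..<k}" by auto
      then show ?thesis using True by (simp add: c_def base_height_def)
    next
      case False
      then have "{k..<0} = insert k {k + 1..<0}" by auto
      then show ?thesis using False by (simp add: c_def base_height_def)
    qed
    then show ?thesis using len[of m k] by simp
  qed
  have s: "c k < c (k + 1)" for k using c[of k 0] ne by simp
  have "juxtapose f y (m, c k + int j) = f (y (m, k)) ! j" if "j < length (f (y (m, k)))" for m k j
  proof -
    have k: "c k \<le> c k + int j" "c k + int j < c (k + 1)" using c[of k m] that by simp_all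
    have "(THE k'. c k' \<le> c k + int j \<and> c k + int j < c (k' + 1)) = k"
      using k grid_unique[of c, OF s] by (intro the_equality) blast+
    then show ?thesis by (simp add: juxtapose_def bh Let_def)
  qed
  then show ?thesis unfolding slicing_def c_def[symmetric] using ne c by simp
qed

lemma slicing_reindex: "slicing w x y c \<Longrightarrow> slicing w x (shift (j, 0) y) (\<lambda>i. c (i + j))"
  unfolding slicing_def shift_def by (simp add: algebra_simps)

text \<open>Inflation by horizontal words is \<open>juxtapose\<close> seen through a transposition.
  The cut 0 lies at 0 because both sums in \<open>base_height\<close> are empty there.\<close>

lemma slicing_ex:
  assumes "\<And>i n. length (w (y (i, n))) = length (w (y (i, 0)))" "\<And>i n. w (y (i, n)) \<noteq> []"
  obtains x c where "slicing w x y c" "c 0 = 0"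
proof -
  have "slicing w (transposed (juxtapose w (transposed y))) (transposed (transposed y)) (base_height w (transposed y) 0)"
    by (rule juxtapose_slicing) (simp_all only: transposed_apply assms(2) not_False_eq_True, rule assms(1))
  then show ?thesis using that by (simp add: base_height_def)
qed

section \<open>Configurations described by their 2 by 2 blocks\<close>

type_synonym table = "nat \<Rightarrow> (nat \<times> nat \<times> nat) list"

definition block :: "'a config \<Rightarrow> int \<Rightarrow> int \<Rightarrow> 'a \<times> 'a \<times> 'a \<times> 'a" where
  "block x m n = (x (m, n), x (m + 1, n), x (m, n + 1), x (m + 1, n + 1))"

text \<open>The order in a 2 by 2 block is lower left, lower right, upper left, upper right. A table maps the lower
  left letter to the possible remaining triples.\<close>

definition tblocks :: "table \<Rightarrow> (nat \<times> nat \<times> nat \<times> nat) set" where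
  "tblocks f = {(a, q). q \<in> set (f a)}"

definition legal :: "table \<Rightarrow> nat config set" where
  "legal f = {x. \<forall>m n. block x m n \<in> tblocks f}"

definition flip_table :: "table \<Rightarrow> table" where
  "flip_table f a = map (\<lambda>(b, c, d). (c, b, d)) (f a)"

lemma legalD: "x \<in> legal f \<Longrightarrow> (x (m + 1, n), x (m, n + 1), x (m + 1, n + 1)) \<in> set (f (x (m, n)))"
  by (auto simp: legal_def block_def tblocks_def)

lemma legalI: "(\<And>m n. (x (m + 1, n), x (m, n + 1), x (m + 1, n + 1)) \<in> set (f (x (m, n)))) \<Longrightarrow> x \<in> legal f"
  by (auto simp: legal_def block_def tblocks_def)

lemma legal_flip: "x \<in> legal f \<Longrightarrow> transposed x \<in> legal (flip_table f)"
  by (rule legalI) (force simp: flip_table_def dest: legalD)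

lemma flip_flip [simp]: "flip_table (flip_table f) = f"
  by (rule ext) (simp add: flip_table_def comp_def case_prod_unfold)

lemma legal_flip_iff: "transposed x \<in> legal (flip_table f) \<longleftrightarrow> x \<in> legal f"
  using legal_flip[of x f] legal_flip[of "transposed x" "flip_table f"] by auto

section \<open>Pruning\<close>

type_synonym ranked = "nat \<Rightarrow> (nat \<times> nat \<times> nat \<times> nat) list"

text \<open>Blocks of rank 0 are kept. A block of positive rank cannot occur because in one of the four directions
  all its possible neighbours have smaller positive rank.\<close>

definition forget :: "ranked \<Rightarrow> table" where
  "forget F a = map (\<lambda>(b, c, d, k). (b, c, d)) (F a)"

definition kept :: "ranked \<Rightarrow> table" where
  "kept F a = concat (map (\<lambda>(b, c, d, k). if k = 0 then [(b, c, d)] else []) (F a))"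

text \<open>The tests concern the neighbours to the right, above, to the left and below. The last
  two run through all letters because a table is indexed by the lower left letter. Nested
  conditionals make the evaluation stop at the first success.\<close>

definition prunable :: "ranked \<Rightarrow> nat list \<Rightarrow> nat \<Rightarrow> nat \<times> nat \<times> nat \<times> nat \<Rightarrow> bool" where
  "prunable F ls a = (\<lambda>(b, c, d, k).
     if k = 0 then True
     else if list_all (\<lambda>(b', c', d', k'). if c' = d then 0 < k' \<and> k' < k else True) (F b) then True
     else if list_all (\<lambda>(b', c', d', k'). if b' = d then 0 < k' \<and> k' < k else True) (F c) then True
     else if list_all (\<lambda>z. list_all (\<lambda>(b', c', d', k').
       if b' = a then if d' = c then 0 < k' \<and> k' < k else True else True) (F z)) ls then True
     else list_all (\<lambda>z. list_all (\<lambda>(b', c', d', k').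
       if c' = a then if d' = b then 0 < k' \<and> k' < k else True else True) (F z)) ls)"

lemma prune:
  assumes x: "x \<in> legal (forget F)" and ls: "\<And>a. F a \<noteq> [] \<Longrightarrow> a \<in> set ls"
    and chk: "list_all (\<lambda>a. list_all (prunable F ls a) (F a)) ls"
  shows "x \<in> legal (kept F)"
proof -
  have ex: "\<exists>k. (x (m + 1, n), x (m, n + 1), x (m + 1, n + 1), k) \<in> set (F (x (m, n)))" for m n
    using legalD[OF x, of m n] by (force simp: forget_def)
  have lx: "x (m, n) \<in> set ls" for m n using ex[of m n] ls by (metis empty_iff list.set(1))
  \<comment> \<open>The claim covers all positions at once, since the neighbour of smaller rank sits
    elsewhere.\<close>
  have *: "\<not> (0 < k \<and> (x (m + 1, n), x (m, n + 1), x (m + 1, n + 1), k) \<in> set (F (x (m, n))))" for k m n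
  proof (induction k arbitrary: m n rule: less_induct)
    case (less k)
    show ?case
    proof
      assume a: "0 < k \<and> (x (m + 1, n), x (m, n + 1), x (m + 1, n + 1), k) \<in> set (F (x (m, n)))"
      have pr: "prunable F ls (x (m, n)) (x (m + 1, n), x (m, n + 1), x (m + 1, n + 1), k)"
        using chk lx[of m n] a unfolding list_all_iff by blast
      have IH: "\<not> (0 < k' \<and> k' < k)" if "(x (m' + 1, n'), x (m', n' + 1), x (m' + 1, n' + 1), k') \<in> set (F (x (m', n')))" for k' m' n'
        using less that by blast
      obtain k1 where k1: "(x (m + 1 + 1, n), x (m + 1, n + 1), x (m + 1 + 1, n + 1), k1) \<in> set (F (x (m + 1, n)))"
        using ex[of "m + 1" n] by blast
      obtain k2 where k2: "(x (m + 1, n + 1), x (m, n + 1 + 1), x (m + 1, n + 1 + 1), k2) \<in> set (F (x (m, n + 1)))"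
        using ex[of m "n + 1"] by blast
      obtain k3 where k3: "(x (m - 1 + 1, n), x (m - 1, n + 1), x (m - 1 + 1, n + 1), k3) \<in> set (F (x (m - 1, n)))"
        using ex[of "m - 1" n] by blast
      obtain k4 where k4: "(x (m + 1, n - 1), x (m, n - 1 + 1), x (m + 1, n - 1 + 1), k4) \<in> set (F (x (m, n - 1)))"
        using ex[of m "n - 1"] by blast
      have 1: "\<not> list_all (\<lambda>(b', c', d', k'). if c' = x (m + 1, n + 1) then 0 < k' \<and> k' < k else True) (F (x (m + 1, n)))"
        using k1 IH[OF k1] unfolding list_all_iff by fastforce
      have 2: "\<not> list_all (\<lambda>(b', c', d', k'). if b' = x (m + 1, n + 1) then 0 < k' \<and> k' < k else True) (F (x (m, n + 1)))"
        using k2 IH[OF k2] unfolding list_all_iff by fastforce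
      have 3: "\<not> list_all (\<lambda>z. list_all (\<lambda>(b', c', d', k').
          if b' = x (m, n) then if d' = x (m, n + 1) then 0 < k' \<and> k' < k else True else True) (F z)) ls"
        using k3 IH[OF k3] lx[of "m - 1" n] unfolding list_all_iff by fastforce
      have 4: "\<not> list_all (\<lambda>z. list_all (\<lambda>(b', c', d', k').
          if c' = x (m, n) then if d' = x (m + 1, n) then 0 < k' \<and> k' < k else True else True) (F z)) ls"
        using k4 IH[OF k4] lx[of m "n - 1"] unfolding list_all_iff by fastforce
      show False using pr a 1 2 3 4 unfolding prunable_def by simp
    qed
  qed
  show ?thesis
  proof (rule legalI)
    fix m n
    obtain k where "(x (m + 1, n), x (m, n + 1), x (m + 1, n + 1), k) \<in> set (F (x (m, n)))" using ex by blast
    moreover from this have "k = 0" using *[where k = k and m = m and n = n] by simp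
    ultimately show "(x (m + 1, n), x (m, n + 1), x (m + 1, n + 1)) \<in> set (kept F (x (m, n)))"
      by (force simp: kept_def)
  qed
qed

section \<open>Slicing before start letters\<close>

text \<open>Explores all pairs of words, one above the other, from a column of start letters to the next one. The
  final test \<open>Q\<close> is a continuation, and running out of fuel counts as failure, so that success also bounds the
  length of the words.\<close>

fun walk :: "table \<Rightarrow> (nat \<Rightarrow> bool) \<Rightarrow> nat \<Rightarrow> nat list \<Rightarrow> nat list \<Rightarrow> nat \<Rightarrow> nat \<Rightarrow>
    (nat list \<Rightarrow> nat list \<Rightarrow> nat \<Rightarrow> nat \<Rightarrow> bool) \<Rightarrow> bool" where
  "walk f s 0 u v a c Q = False"
| "walk f s (Suc k) u v a c Q = list_all (\<lambda>(b, c', d). if c' = c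
     then if s b then Q (u @ [a]) (v @ [c]) b d else walk f s k (u @ [a]) (v @ [c]) b d Q else True) (f a)"

fun hits_start :: "table \<Rightarrow> (nat \<Rightarrow> bool) \<Rightarrow> nat \<Rightarrow> nat \<Rightarrow> bool" where
  "hits_start f s 0 a = False"
| "hits_start f s (Suc k) a = list_all (\<lambda>(b, c, d). if s b then True else hits_start f s k b) (f a)"

text \<open>Decodes a word into its letter. The value \<open>undefined\<close> for an unknown word
  is harmless because \<open>slicing_check\<close> compares \<open>w (idx u)\<close> with
  \<open>u\<close>.\<close>

fun index :: "('i \<Rightarrow> 'a list) \<Rightarrow> 'i list \<Rightarrow> 'a list \<Rightarrow> 'i" where
  "index w [] u = undefined"
| "index w (i # is) u = (if w i = u then i else index w is u)"

text \<open>The three conditions: start letters fill whole columns, every row meets one within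
  \<open>K\<close> steps, and two consecutive pairs of words form a block listed in
  \<open>g\<close>. Decoding is tested for the lower left word only, since every word of a
  configuration takes this place in some block.\<close>

definition slicing_check :: "table \<Rightarrow> nat list \<Rightarrow> (nat \<Rightarrow> bool) \<Rightarrow> nat \<Rightarrow> (nat \<Rightarrow> nat list) \<Rightarrow> (nat list \<Rightarrow> nat) \<Rightarrow> table \<Rightarrow> bool" where
  "slicing_check f ls s K w idx g \<longleftrightarrow>
     list_all (\<lambda>a. list_all (\<lambda>(b, c, d). s a = s c) (f a)) ls \<and>
     list_all (\<lambda>a. hits_start f s K a) ls \<and>
     list_all (\<lambda>a. if s a then list_all (\<lambda>(b, c, d).
       walk f s K [] [] a c (\<lambda>u v b d. if w (idx u) = u then
         walk f s K [] [] b d (\<lambda>u' v' b d. (idx u', idx v, idx v') \<in> set (g (idx u))) else False)) (f a) else True) ls"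

text \<open>The two rows of \<open>x\<close> follow one of the branches explored by
  \<open>walk\<close>, which ends at the first start column \<open>m'\<close> after
  \<open>m\<close>. So the final test holds for the words read off there.\<close>

lemma walk_path:
  assumes x: "x \<in> legal f" and "walk f s K u v (x (m, n)) (x (m, n + 1)) Q"
    and "m < m'" "s (x (m', n))" "\<And>j. m < j \<Longrightarrow> j < m' \<Longrightarrow> \<not> s (x (j, n))"
  shows "Q (u @ map (\<lambda>j. x (j, n)) [m..m' - 1]) (v @ map (\<lambda>j. x (j, n + 1)) [m..m' - 1]) (x (m', n)) (x (m', n + 1))"
  using assms(2-)
proof (induction K arbitrary: m u v)
  case (Suc K)
  have l: "(x (m + 1, n), x (m, n + 1), x (m + 1, n + 1)) \<in> set (f (x (m, n)))" using legalD[OF x] .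
  have up: "[m..m' - 1] = m # [m + 1..m' - 1]" using Suc.prems by (simp add: upto.simps)
  show ?case
  proof (cases "m' = m + 1")
    case True
    then show ?thesis using Suc.prems l by (auto simp: list_all_iff up)
  next
    case False
    then have "\<not> s (x (m + 1, n))" using Suc.prems by simp
    then have "walk f s K (u @ [x (m, n)]) (v @ [x (m, n + 1)]) (x (m + 1, n)) (x (m + 1, n + 1)) Q"
      using Suc.prems(1) l by (auto simp: list_all_iff)
    from Suc.IH[OF this] Suc.prems False show ?thesis by (simp add: up)
  qed
qed simp

lemma hits_start_path:
  assumes x: "x \<in> legal f" and "hits_start f s K (x (m, n))"
  shows "\<exists>l. m < l \<and> l \<le> m + int K \<and> s (x (l, n))"
  using assms(2-)
proof (induction K arbitrary: m)
  case (Suc K)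
  have "s (x (m + 1, n)) \<or> hits_start f s K (x (m + 1, n))"
    using Suc.prems legalD[OF x, of m n] by (fastforce simp: list_all_iff split: if_splits)
  then show ?case
  proof
    assume "s (x (m + 1, n))" then show ?thesis by (intro exI[of _ "m + 1"]) simp
  next
    assume "hits_start f s K (x (m + 1, n))"
    from Suc.IH[OF this] obtain l where "m + 1 < l" "l \<le> m + 1 + int K" "s (x (l, n))" by blast
    then show ?thesis by (intro exI[of _ l]) simp
  qed
qed simp

lemma slicing_exists:
  assumes x: "x \<in> legal f" and ls: "\<And>a. f a \<noteq> [] \<Longrightarrow> a \<in> set ls"
    and chk: "slicing_check f ls s K w idx g"
  obtains y c where "y \<in> legal g" "slicing w x y c" "recognizable x y c"
proof -
  have lx: "x (m, n) \<in> set ls" for m n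
    using legalD[OF x, of m n] ls by (metis empty_iff list.set(1))
  have hom1: "s (x (m, n)) = s (x (m, n + 1))" for m n
    using chk legalD[OF x, of m n] lx[of m n] unfolding slicing_check_def list_all_iff by fastforce
  have hom: "s (x (m, n)) = s (x (m, 0))" for m n
  proof (induction n rule: int_induct[where k = 0])
    case (step2 i) then show ?case using hom1[of m "i - 1"] by simp
  qed (use hom1 in auto)
  have hits_start: "\<exists>l. m < l \<and> l \<le> m + int K \<and> s (x (l, 0))" for m
    using chk lx[of m 0] by (intro hits_start_path[OF x]) (auto simp: slicing_check_def list_all_iff)
  have up: "\<exists>k>m. s (x (k, 0))" for m using hits_start[of m] by blast
  \<comment> \<open>Going right from \<open>m - int K - 1\<close>, a start column appears at
    \<open>m - 1\<close> at the latest. This is why \<open>hits_start\<close> carries a bound: it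
    yields cuts to the left as well.\<close>
  have down: "\<exists>k<m. s (x (k, 0))" for m using hits_start[of "m - int K - 1"] by force
  obtain c :: "int \<Rightarrow> int" where c0: "(\<forall>i. c i < c (i + 1)) \<and> (\<forall>m. s (x (m, 0)) \<longleftrightarrow> m \<in> range c)"
    using grid_extend[of "\<lambda>m. s (x (m, 0))", OF up down] by (rule exE)
  have c: "\<And>i. c i < c (i + 1)" "\<And>m. s (x (m, 0)) \<longleftrightarrow> m \<in> range c" using c0 by blast+
  define U where "U i n = map (\<lambda>j. x (j, n)) [c i..c (i + 1) - 1]" for i n
  define y where "y = (\<lambda>(i, n). idx (U i n))"
  have sm: "strict_mono c" using grid_mono c(1) by blast
  have between: "\<not> s (x (j, n))" if j: "c i < j" "j < c (i + 1)" for i j n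
  proof
    assume "s (x (j, n))"
    then obtain k where "j = c k" using c(2)[of j] hom[of j n] by auto
    then show False using j strict_mono_less[OF sm] by auto
  qed
  have sc: "s (x (c i, n))" for i n using c(2)[of "c i"] hom[of "c i" n] by simp
  define Q where "Q = (\<lambda>u v b d. if w (idx u) = u then
         walk f s K [] [] b d (\<lambda>u' v' b d. (idx u', idx v, idx v') \<in> set (g (idx u))) else False)"
  have c3: "list_all (\<lambda>a. if s a then list_all (\<lambda>(b, c, d). walk f s K [] [] a c Q) (f a) else True) ls"
    using chk unfolding slicing_check_def Q_def by (elim conjE)
  have chk3: "walk f s K [] [] a c Q" if "a \<in> set ls" "s a" "(b, c, d) \<in> set (f a)" for a b c d
    using bspec[OF c3[unfolded list_all_iff] that(1)] that(2,3) by auto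
  have main: "w (idx (U i n)) = U i n \<and>
      (idx (U (i + 1) n), idx (U i (n + 1)), idx (U (i + 1) (n + 1))) \<in> set (g (idx (U i n)))" for i n
  proof -
    have "walk f s K [] [] (x (c i, n)) (x (c i, n + 1)) Q"
      by (rule chk3[OF lx sc legalD[OF x]])
    from walk_path[OF x this, of "c (i + 1)"]
    have 1: "w (idx (U i n)) = U i n" and
      2: "walk f s K [] [] (x (c (i + 1), n)) (x (c (i + 1), n + 1))
         (\<lambda>u' v' b d. (idx u', idx (U i (n + 1)), idx v') \<in> set (g (idx (U i n))))"
      using c(1) sc between by (simp_all add: U_def Q_def split: if_splits)
    from walk_path[OF x 2, of "c (i + 1 + 1)"] show ?thesis
      using 1 c(1)[of "i + 1"] sc between[of "i + 1"] by (simp add: U_def)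
  qed
  have len: "int (length (U i n)) = c (i + 1) - c i" for i n using c(1)[of i] by (simp add: U_def)
  have "slicing w x y c"
    unfolding slicing_def
  proof (intro allI conjI impI)
    fix i n
    have wy: "w (y (i, n)) = U i n" using main by (simp add: y_def)
    show "w (y (i, n)) \<noteq> []" using wy len[of i n] c(1)[of i] by auto
    show "c (i + 1) = c i + int (length (w (y (i, n))))" using wy len by simp
    fix k assume "k < length (w (y (i, n)))"
    then have "int k < c (i + 1) - c i" using len[of i n] wy by simp
    then show "x (c i + int k, n) = w (y (i, n)) ! k"
      unfolding wy using len[of i n] nth_upto[of "c i" k "c (i + 1) - 1"] by (simp add: U_def)
  qed
  moreover have "y \<in> legal g" using main by (intro legalI) (simp add: y_def)
  moreover have "recognizable x y c"
  \<comment> \<open>Here a cut is visible from the letter to its right alone.\<close>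
  proof (rule slicing_recognizable[OF \<open>slicing w x y c\<close>, where D = "\<lambda>_. s"])
    show "inj_on w (range y)"
    proof (rule inj_on_inverseI[of _ idx])
      fix a assume "a \<in> range y"
      then obtain i n where "a = y (i, n)" by auto
      then show "idx (w a) = a" using main[of i n] by (simp add: y_def)
    qed
    show "s (x (m, n)) \<longleftrightarrow> m \<in> range c" for m n using c(2)[of m] hom[of m n] by simp
  qed
  ultimately show ?thesis using that by blast
qed

section \<open>Blocks in images\<close>

fun quads :: "'a list \<Rightarrow> 'a list \<Rightarrow> ('a \<times> 'a \<times> 'a \<times> 'a) list" where
  "quads (a # b # u) (c # d # v) = (a, b, c, d) # quads (b # u) (d # v)"
| "quads _ _ = []"

fun image_blocks :: "('b \<Rightarrow> 'a list) \<Rightarrow> 'b \<times> 'b \<times> 'b \<times> 'b \<Rightarrow> ('a \<times> 'a \<times> 'a \<times> 'a) list" where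
  "image_blocks w (a, b, c, d) = quads (w a @ w b) (w c @ w d)"

lemma set_quads: "set (quads u v) = {(u ! k, u ! Suc k, v ! k, v ! Suc k) | k. Suc k < length u \<and> Suc k < length v}"
proof (induction u v rule: quads.induct)
  case (1 a b u c d v)
  show ?case (is "?L = ?R")
  proof
    show "?L \<subseteq> ?R"
    proof
      fix q assume "q \<in> ?L"
      then consider "q = (a, b, c, d)" | "q \<in> set (quads (b # u) (d # v))" by auto
      then show "q \<in> ?R"
      proof cases
        case 1
        then show ?thesis by (intro CollectI exI[of _ 0]) simp
      next
        case 2
        then obtain k where "q = ((b # u) ! k, (b # u) ! Suc k, (d # v) ! k, (d # v) ! Suc k)"
          "Suc k < length (b # u) \<and> Suc k < length (d # v)" unfolding 1 by blast
        then show ?thesis by (intro CollectI exI[of _ "Suc k"]) simp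
      qed
    qed
    show "?R \<subseteq> ?L"
    proof
      fix q assume "q \<in> ?R"
      then obtain k where k: "q = ((a # b # u) ! k, (a # b # u) ! Suc k, (c # d # v) ! k, (c # d # v) ! Suc k)"
        "Suc k < length (a # b # u)" "Suc k < length (c # d # v)" by blast
      show "q \<in> ?L"
      proof (cases k)
        case 0
        then show ?thesis using k by simp
      next
        case (Suc k')
        then have "q \<in> set (quads (b # u) (d # v))" unfolding 1 using k by (intro CollectI exI[of _ k']) simp
        then show ?thesis by simp
      qed
    qed
  qed
qed auto

text \<open>The window starts in the cell \<open>i\<close> and is two columns wide, so its second
  column is at worst the first one of the cell \<open>i + 1\<close>, which is nonempty.\<close>

lemma slicing_image_blocks:
  assumes x: "slicing w x y c" and i: "c i \<le> m" "m < c (i + 1)"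
  shows "block x m n \<in> set (image_blocks w (block y i n))"
proof -
  define k where "k = nat (m - c i)"
  have len: "length (w (y (i, n + 1))) = length (w (y (i, n)))" "length (w (y (i + 1, n + 1))) = length (w (y (i + 1, n)))"
    using slicingD(2)[OF x, of i n] slicingD(2)[OF x, of i "n + 1"] slicingD(2)[OF x, of "i + 1" n] slicingD(2)[OF x, of "i + 1" "n + 1"] by auto
  have ne: "0 < length (w (y (i + 1, n)))" for n using x by (auto simp: slicing_def)
  have k: "k < length (w (y (i, n)))" using slicing_at(2)[OF x i] by (simp add: k_def)
  have at0: "x (m, n') = (w (y (i, n')) @ w (y (i + 1, n'))) ! k" for n'
    using slicing_at[OF x i, of n'] by (simp add: k_def nth_append)
  have at1: "x (m + 1, n') = (w (y (i, n')) @ w (y (i + 1, n'))) ! Suc k" for n'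
  proof (cases "m + 1 < c (i + 1)")
    case True
    moreover have "nat (m + 1 - c i) = Suc k" using i by (simp add: k_def)
    ultimately show ?thesis using slicing_at[OF x, of i "m + 1" n'] i by (simp add: nth_append)
  next
    case False
    then have m: "m + 1 = c (i + 1)" using i by simp
    then have "Suc k = length (w (y (i, n')))" using slicingD(2)[OF x, of i n'] i by (simp add: k_def)
    then show ?thesis using slicingD(3)[OF x, of 0 "i + 1" n'] ne[of n'] m by (simp add: nth_append)
  qed
  have "Suc k < length (w (y (i, n)) @ w (y (i + 1, n)))"
      "Suc k < length (w (y (i, n + 1)) @ w (y (i + 1, n + 1)))"
    unfolding length_append using k len ne[of n] by linarith+
  then show ?thesis unfolding block_def image_blocks.simps set_quads at0 at1 by blast
qed

text \<open>The converse direction, including the quadruples that lie entirely in the right cell: a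
  block that occurs in \<open>y\<close> forces all of its image blocks to occur in
  \<open>x\<close>.\<close>

lemma image_blocks_slicing:
  assumes x: "slicing w x y c" and q: "q \<in> set (image_blocks w (block y i n))"
  shows "\<exists>m. block x m n = q"
proof -
  obtain k where k: "Suc k < length (w (y (i, n)) @ w (y (i + 1, n)))"
    "Suc k < length (w (y (i, n + 1)) @ w (y (i + 1, n + 1)))"
    and qk: "q = ((w (y (i, n)) @ w (y (i + 1, n))) ! k, (w (y (i, n)) @ w (y (i + 1, n))) ! Suc k,
      (w (y (i, n + 1)) @ w (y (i + 1, n + 1))) ! k, (w (y (i, n + 1)) @ w (y (i + 1, n + 1))) ! Suc k)"
    using q by (auto simp: block_def set_quads)
  have at: "x (c i + int j, n') = (w (y (i, n')) @ w (y (i + 1, n'))) ! j"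
    if "j < length (w (y (i, n')) @ w (y (i + 1, n')))" for j n'
  proof (cases "j < length (w (y (i, n')))")
    case True then show ?thesis using slicingD(3)[OF x] by (simp add: nth_append)
  next
    case False
    then have *: "c i + int j = c (i + 1) + int (j - length (w (y (i, n'))))"
      using slicingD(2)[OF x, of i n'] by simp
    show ?thesis unfolding * using slicingD(3)[OF x, of "j - length (w (y (i, n')))" "i + 1" n'] False that
      by (simp add: nth_append)
  qed
  have "block x (c i + int k) n = q"
    using at[of k n] at[of "Suc k" n] at[of k "n + 1"] at[of "Suc k" "n + 1"] k qk
    by (simp add: block_def algebra_simps)
  then show ?thesis by blast
qed

definition legal_on :: "table \<Rightarrow> int set \<Rightarrow> int set \<Rightarrow> nat config \<Rightarrow> bool" where
  "legal_on f I J x \<longleftrightarrow> (\<forall>m\<in>I. \<forall>n\<in>J. block x m n \<in> tblocks f)"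

definition image_check :: "table \<Rightarrow> nat list \<Rightarrow> (nat \<Rightarrow> nat list) \<Rightarrow> table \<Rightarrow> bool" where
  "image_check g ls w f \<longleftrightarrow> list_all (\<lambda>a. list_all (\<lambda>(b, c, d).
     list_all (\<lambda>(p, q). q \<in> set (f p)) (image_blocks w (a, b, c, d))) (g a)) ls"

lemma image_legal:
  assumes "image_check g ls w f" "\<And>a. g a \<noteq> [] \<Longrightarrow> a \<in> set ls" "q \<in> tblocks g" "q' \<in> set (image_blocks w q)"
  shows "q' \<in> tblocks f"
proof -
  obtain a b c d where q: "q = (a, b, c, d)" "(b, c, d) \<in> set (g a)"
    using assms(3) by (auto simp: tblocks_def)
  then have "a \<in> set ls" using assms(2)[of a] by force
  then have "list_all (\<lambda>(b, c, d). list_all (\<lambda>(p, q). q \<in> set (f p)) (image_blocks w (a, b, c, d))) (g a)"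
    using assms(1) unfolding image_check_def list_all_iff by (rule bspec[rotated])
  then have "list_all (\<lambda>(p, q). q \<in> set (f p)) (image_blocks w (a, b, c, d))"
    using q(2) unfolding list_all_iff by (auto dest: bspec)
  then show ?thesis using assms(4) q(1) by (auto simp: tblocks_def list_all_iff)
qed

lemma legal_on_slicing:
  assumes "image_check g ls w f" "\<And>a. g a \<noteq> [] \<Longrightarrow> a \<in> set ls" "slicing w x y c" "legal_on g I J y"
  shows "legal_on f {m. \<exists>i\<in>I. c i \<le> m \<and> m < c (i + 1)} J x"
  unfolding legal_on_def
proof (intro ballI)
  fix m n assume "m \<in> {m. \<exists>i\<in>I. c i \<le> m \<and> m < c (i + 1)}" "n \<in> J"
  then obtain i where i: "i \<in> I" "c i \<le> m" "m < c (i + 1)" by blast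
  then have "block y i n \<in> tblocks g" using assms(4) \<open>n \<in> J\<close> by (simp add: legal_on_def)
  from image_legal[OF assms(1,2) this slicing_image_blocks[OF assms(3) i(2,3)]] show "block x m n \<in> tblocks f" .
qed

section \<open>Spaces of configurations\<close>

abbreviation full :: "'a set \<Rightarrow> 'a config topology" where
  "full A \<equiv> product_topology (\<lambda>_. discrete_topology A) UNIV"

lemma topspace_full: "topspace (full A) = {x. range x \<subseteq> A}"
  by (auto simp: PiE_iff)

text \<open>A basic open set of the product restricts finitely many coordinates, so closedness
  amounts to stability under approximation on finite sets of positions.\<close>

lemma closedin_fullI:
  assumes sub: "\<And>x. x \<in> X \<Longrightarrow> range x \<subseteq> A"
    and lim: "\<And>x. range x \<subseteq> A \<Longrightarrow> (\<And>F. finite F \<Longrightarrow> \<exists>x'\<in>X. \<forall>n\<in>F. x' n = x n) \<Longrightarrow> x \<in> X"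
  shows "closedin (full A) X"
proof -
  have "openin (full A) (topspace (full A) - X)"
    unfolding openin_product_topology_alt
  proof (intro ballI)
    fix x assume x: "x \<in> topspace (full A) - X"
    then have rx: "range x \<subseteq> A" by (simp add: topspace_full del: topspace_product_topology)
    then obtain F where F: "finite F" "\<And>x'. x' \<in> X \<Longrightarrow> \<exists>n\<in>F. x' n \<noteq> x n"
    proof -
      have "\<not> (\<forall>F. finite F \<longrightarrow> (\<exists>x'\<in>X. \<forall>n\<in>F. x' n = x n))" using lim[OF rx] x by blast
      then show ?thesis using that by blast
    qed
    define U where "U n = (if n \<in> F then {x n} else A)" for n
    have "{i \<in> UNIV. U i \<noteq> topspace (discrete_topology A)} \<subseteq> F" by (auto simp: U_def)
    moreover have "\<forall>i. openin (discrete_topology A) (U i)" using rx by (simp add: U_def image_subset_iff)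
    moreover have "x n \<in> U n" for n using rx by (auto simp: U_def)
    then have "x \<in> Pi\<^sub>E UNIV U" by (simp add: PiE_UNIV_domain)
    moreover have "Pi\<^sub>E UNIV U \<subseteq> topspace (full A) - X"
    proof
      fix z assume z: "z \<in> Pi\<^sub>E UNIV U"
      then have zU: "z n \<in> U n" for n by (rule PiE_mem) simp
      then have zF: "z n = x n" if "n \<in> F" for n using zU[of n] that by (simp add: U_def)
      have "z n \<in> A" for n using zU[of n] zF[of n] rx by (cases "n \<in> F") (auto simp: U_def)
      then have "range z \<subseteq> A" by blast
      moreover have "z \<notin> X" using F(2)[of z] zF by blast
      ultimately show "z \<in> topspace (full A) - X" by (simp add: topspace_full del: topspace_product_topology)
    qed
    ultimately show "\<exists>U. finite {i \<in> UNIV. U i \<noteq> topspace (discrete_topology A)} \<and>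
        (\<forall>i\<in>UNIV. openin (discrete_topology A) (U i)) \<and> x \<in> Pi\<^sub>E UNIV U \<and> Pi\<^sub>E UNIV U \<subseteq> topspace (full A) - X"
      using F(1) finite_subset by blast
  qed
  then show ?thesis using sub by (auto simp: closedin_def topspace_full simp del: topspace_product_topology)
qed

lemma closedin_fullD:
  assumes X: "closedin (full A) X" and x: "range x \<subseteq> A"
    and lim: "\<And>F. finite F \<Longrightarrow> \<exists>x'\<in>X. \<forall>n\<in>F. x' n = x n"
  shows "x \<in> X"
proof (rule ccontr)
  assume "x \<notin> X"
  then have "x \<in> topspace (full A) - X" using x by (simp add: topspace_full del: topspace_product_topology)
  moreover have "openin (full A) (topspace (full A) - X)" using X by blast
  ultimately obtain U where U: "finite {i \<in> UNIV. U i \<noteq> topspace (discrete_topology A)}"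
    "x \<in> Pi\<^sub>E UNIV U" "Pi\<^sub>E UNIV U \<subseteq> topspace (full A) - X"
    unfolding openin_product_topology_alt by blast
  obtain x' where x': "x' \<in> X" "\<And>n. U n \<noteq> A \<Longrightarrow> x' n = x n"
    using lim[OF U(1)] by auto
  have "range x' \<subseteq> A" using X x'(1) closedin_subset[OF X] by (auto simp: topspace_full simp del: topspace_product_topology)
  moreover have "x n \<in> U n" for n using PiE_mem[OF U(2)] by blast
  ultimately have "x' n \<in> U n" for n using x'(2)[of n] by (cases "U n = A") (auto simp del: split_paired_All)
  then have "x' \<in> Pi\<^sub>E UNIV U" by (simp add: PiE_UNIV_domain)
  then show False using U(3) x'(1) by blast
qed

lemma full_compact:
  assumes "finite A" and closed: "\<And>i. i \<in> I \<Longrightarrow> closedin (full A) (S i)"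
    and fip: "\<And>J. finite J \<Longrightarrow> J \<subseteq> I \<Longrightarrow> \<exists>x. \<forall>i\<in>J. x \<in> S i"
  shows "\<exists>x. \<forall>i\<in>I. x \<in> S i"
proof -
  have "compact_space (full A)"
    by (simp add: compact_space_product_topology compact_space_discrete_topology assms(1))
  moreover have "\<Inter>F \<noteq> {}" if F: "finite F" "F \<subseteq> S ` I" for F
  proof -
    obtain J where "J \<subseteq> I" "finite J" "F = S ` J" using finite_subset_image[OF F] by blast
    then show ?thesis using fip[of J] by auto
  qed
  moreover have "\<forall>C\<in>S ` I. closedin (full A) C" using closed by blast
  ultimately have "\<Inter>(S ` I) \<noteq> {}" unfolding compact_space_fip by presburger
  then show ?thesis by blast
qed

text \<open>For a limit \<open>z\<close> of images, the preimages in \<open>X\<close> of the single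
  coordinates of \<open>z\<close> are closed and have the finite intersection property. Compactness
  yields a common element, which is mapped to \<open>z\<close>. The finite set of dependence may
  vary with the position, as it does for juxtapositions.\<close>

lemma closedin_local_image:
  assumes "finite A" and X: "closedin (full A) X" and fB: "\<And>x. x \<in> X \<Longrightarrow> range (f x) \<subseteq> B"
    and loc: "\<And>n. \<exists>F. finite F \<and> (\<forall>x\<in>X. \<forall>x'\<in>X. (\<forall>k\<in>F. x k = x' k) \<longrightarrow> f x n = f x' n)"
  shows "closedin (full B) (f ` X)"
proof (rule closedin_fullI)
  show "range x \<subseteq> B" if "x \<in> f ` X" for x using fB that by auto
  fix z assume z: "range z \<subseteq> B" and lim: "\<And>F. finite F \<Longrightarrow> \<exists>x'\<in>f ` X. \<forall>n\<in>F. x' n = z n"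
  define S where "S n = {x \<in> X. f x n = z n}" for n
  have XA: "range x \<subseteq> A" if "x \<in> X" for x
    using closedin_subset[OF X] that by (auto simp: topspace_full simp del: topspace_product_topology)
  have "closedin (full A) (S n)" for n
  proof (rule closedin_fullI)
    show "range x \<subseteq> A" if "x \<in> S n" for x using that XA by (simp add: S_def)
    fix x assume x: "range x \<subseteq> A" and limx: "\<And>F. finite F \<Longrightarrow> \<exists>x'\<in>S n. \<forall>n\<in>F. x' n = x n"
    have xX: "x \<in> X"
    proof (rule closedin_fullD[OF X x])
      show "\<exists>x'\<in>X. \<forall>k\<in>F. x' k = x k" if "finite F" for F
        using limx[OF that] unfolding S_def by blast
    qed
    obtain F where F: "finite F" and eq: "\<forall>x\<in>X. \<forall>x'\<in>X. (\<forall>k\<in>F. x k = x' k) \<longrightarrow> f x n = f x' n"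
      using loc[of n] by (elim exE conjE)
    obtain x' where x': "x' \<in> S n" "\<forall>k\<in>F. x' k = x k" using limx[OF F] by blast
    then have "f x' n = f x n" using eq xX unfolding S_def by blast
    then show "x \<in> S n" using x' xX unfolding S_def by simp
  qed
  moreover have fip: "\<exists>x. \<forall>n\<in>J. x \<in> S n" if "finite J" for J
  proof -
    obtain x where "x \<in> X" "\<forall>n\<in>J. f x n = z n" using lim[OF \<open>finite J\<close>] by blast
    then show ?thesis unfolding S_def by blast
  qed
  ultimately have "\<exists>x. \<forall>n\<in>UNIV. x \<in> S n" by (rule full_compact[OF assms(1)])
  then obtain x where x: "x \<in> S n" for n by blast
  then have "f x = z" by (auto simp: S_def)
  then show "z \<in> f ` X" using x by (auto simp: S_def)
qed

section \<open>Repetitivity, minimality and local dependence of images\<close>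

definition repetitive :: "'a config set \<Rightarrow> bool" where
  "repetitive X \<longleftrightarrow> (\<forall>x\<in>X. \<forall>x'\<in>X. \<forall>N. occurs N N x x')"

text \<open>Every \<open>x\<close> in \<open>X\<close> is approximated on finite sets by shifts of
  one fixed element of \<open>Y\<close>, hence belongs to \<open>Y\<close>, which is closed and
  invariant.\<close>

lemma repetitive_minimal:
  assumes X: "subshift A X" "repetitive X"
  shows "minimal_subshift A X"
proof -
  have "Y = X" if Y: "Y \<subseteq> X" "Y \<noteq> {}" "subshift A Y" for Y
  proof -
  obtain x' where x': "x' \<in> Y" using Y(2) by (meson ex_in_conv)
  have "x \<in> Y" if x: "x \<in> X" for x
  proof (rule closedin_fullD[of A])
    show "closedin (full A) Y" using Y(3) unfolding subshift_def by (rule conjunct1)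
    have "closedin (full A) X" using X(1) unfolding subshift_def by (rule conjunct1)
    from closedin_subset[OF this] x show "range x \<subseteq> A" unfolding topspace_full by blast
    fix F :: "(int \<times> int) set" assume F: "finite F"
    define N where "N = Max ((\<lambda>(m, n). \<bar>m\<bar> + \<bar>n\<bar>) ` insert (0, 0) F)"
    have N: "\<bar>m\<bar> \<le> N" "\<bar>n\<bar> \<le> N" if "(m, n) \<in> F" for m n
    proof -
      have "\<bar>m\<bar> + \<bar>n\<bar> \<le> N" unfolding N_def
      proof (rule Max_ge)
        show "\<bar>m\<bar> + \<bar>n\<bar> \<in> (\<lambda>(m, n). \<bar>m\<bar> + \<bar>n\<bar>) ` insert (0, 0) F"
          by (rule image_eqI[of _ _ "(m, n)"]) (simp_all add: that)
      qed (simp add: F)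
      then show "\<bar>m\<bar> \<le> N" "\<bar>n\<bar> \<le> N" by linarith+
    qed
    have "occurs (2 * N + 1) (2 * N + 1) x x'" using X(2) x subsetD[OF Y(1) x'] unfolding repetitive_def by blast
    \<comment> \<open>The square of side \<open>2 * N + 1\<close> centred at the origin contains
      \<open>F\<close>. Its copy has the corner \<open>(a, b)\<close>, hence the centre
      \<open>(a + N, b + N)\<close>.\<close>
    then obtain a b where ab: "\<forall>s\<in>{0..<2 * N + 1}. \<forall>t\<in>{0..<2 * N + 1}. x (- N + s, - N + t) = x' (a + s, b + t)"
      unfolding occurs_def by blast
    have "shift (a + N, b + N) ` Y = Y" using Y(3) unfolding subshift_def by blast
    then have "shift (a + N, b + N) x' \<in> Y" using x' by blast
    moreover have "shift (a + N, b + N) x' p = x p" if "p \<in> F" for p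
    proof -
      obtain m n where p: "p = (m, n)" by (cases p)
      then have "m + N \<in> {0..<2 * N + 1}" "n + N \<in> {0..<2 * N + 1}" using N[of m n] that by auto
      from ab[rule_format, OF this] p show ?thesis by (simp add: shift_def algebra_simps)
    qed
    ultimately show "\<exists>x'\<in>Y. \<forall>n\<in>F. x' n = x n" by blast
  qed
  then show "Y = X" using Y(1) by blast
  qed
  then show ?thesis using X(1) unfolding minimal_subshift_def by blast
qed

text \<open>Cells have width at least 1, so finitely many of them around the cut 0 already cover the
  position \<open>m\<close>, and the cuts between them are determined by the letters of one
  row.\<close>

lemma slicing_local:
  assumes x: "slicing w x y c" and x': "slicing w x' y' c'" and "c 0 = c' 0"
    and eq: "\<And>i. \<bar>i\<bar> \<le> \<bar>m\<bar> + \<bar>c 0\<bar> + 1 \<Longrightarrow> y (i, n) = y' (i, n)"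
  shows "x (m, n) = x' (m, n)"
proof -
  define M where "M = \<bar>m\<bar> + \<bar>c 0\<bar> + 1"
  have up: "int k \<le> M + 1 \<Longrightarrow> c (int k) = c' (int k)" for k
  proof (induction k)
    case (Suc k)
    then show ?case using slicingD(2)[OF x, of "int k" n] slicingD(2)[OF x', of "int k" n] eq[of "int k"]
      by (simp add: M_def algebra_simps)
  qed (simp add: assms(3))
  have down: "int k \<le> M \<Longrightarrow> c (- int k) = c' (- int k)" for k
  proof (induction k)
    case (Suc k)
    then show ?case using slicingD(2)[OF x, of "- int (Suc k)" n] slicingD(2)[OF x', of "- int (Suc k)" n] eq[of "- int (Suc k)"]
      by (simp add: M_def algebra_simps)
  qed (simp add: assms(3))
  have c: "c i = c' i" if "- M \<le> i" "i \<le> M + 1" for i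
    using up[of "nat i"] down[of "nat (- i)"] that by (cases "0 \<le> i") simp_all
  have step: "\<And>i. c i + 1 \<le> c (i + 1)" using slicingD(1)[OF x] by (simp add: add1_zle_eq)
  obtain i where i: "c i \<le> m" "m < c (i + 1)" using grid_cell[of c m] slicingD(1)[OF x] by blast
  have sm: "strict_mono c" using grid_mono slicingD(1)[OF x] by blast
  have "0 \<le> M" by (simp add: M_def)
  then have "c 0 + M \<le> c M" "c (- M) + M \<le> c 0"
    using grid_le[of c 1 0 M] grid_le[of c 1 "- M" 0] step by simp_all
  moreover have "m < c 0 + M" "c 0 - M \<le> m" unfolding M_def by linarith+
  ultimately have "m < c M" "c (- M) \<le> m" by linarith+
  then have "c i < c M" "c (- M) < c (i + 1)" using i by linarith+
  then have iM: "i < M" "- M < i + 1" using strict_mono_less[OF sm] by blast+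
  then have "y (i, n) = y' (i, n)" using eq[of i] by (simp add: M_def)
  moreover have "c' i = c i" "c' (i + 1) = c (i + 1)" using c[of i] c[of "i + 1"] iM by simp_all
  ultimately show ?thesis using slicing_at(1)[OF x i, of n] slicing_at(1)[OF x', of i m n] i by simp
qed

section \<open>The tables\<close>

text \<open>The tables were found by computer. Letters of \<open>tab5\<close> and \<open>tab6\<close> are indices in \<open>T5\<close>, where \<open>tab6\<close> describes
  the configurations \<open>shear x\<close>. Letters of \<open>tabA\<close> are indices of \<open>word1\<close> and of \<open>word3\<close>, letters of \<open>tabC\<close> are
  indices of \<open>word2\<close>. Since \<open>word2\<close> is vertical, \<open>tabC\<close> lists the transposed blocks.\<close>

definition h_succ :: "nat \<Rightarrow> nat list" where
  "h_succ a = (if a = 0 then [2, 10]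
    else if a = 1 then [0, 12]
    else if a = 2 then [11]
    else if a = 3 then [2, 10]
    else if a = 4 then [0, 12]
    else if a = 5 then [1, 9]
    else if a = 6 then [5]
    else if a = 7 then [4]
    else if a = 8 then [4]
    else if a = 9 then [8]
    else if a = 10 then [6, 7]
    else if a = 11 then [3]
    else if a = 12 then [3]
    else if a = 13 then [21]
    else if a = 14 then [22, 23, 27]
    else if a = 15 then [20]
    else if a = 16 then [15]
    else if a = 17 then [15]
    else if a = 18 then [14]
    else if a = 19 then [14]
    else if a = 20 then [17, 19]
    else if a = 21 then [16, 18]
    else if a = 22 then [13, 28]
    else if a = 23 then [13, 28]
    else if a = 24 then [22, 23, 27]
    else if a = 25 then [17, 19]
    else if a = 26 then [25]
    else if a = 27 then [26]
    else if a = 28 then [24]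
    else [])"

definition v_succ :: "nat \<Rightarrow> nat list" where
  "v_succ a = (if a = 0 then [1, 16, 17, 18, 19, 23]
    else if a = 1 then [0, 2, 13, 14, 15, 20, 21, 22]
    else if a = 2 then [0, 2, 13, 14, 15, 20, 21, 22]
    else if a = 3 then [1, 16, 17, 18, 19, 23]
    else if a = 4 then [6, 7, 8, 11, 12, 26, 28]
    else if a = 5 then [1, 16, 17, 18, 19, 23]
    else if a = 6 then [0, 2, 13, 14, 15, 20, 21, 22]
    else if a = 7 then [0, 2, 13, 14, 15, 20, 21, 22]
    else if a = 8 then [3, 4, 5, 9, 10, 24, 25, 27]
    else if a = 9 then [0, 2, 13, 14, 15, 20, 21, 22]
    else if a = 10 then [0, 2, 13, 14, 15, 20, 21, 22]
    else if a = 11 then [0, 2, 13, 14, 15, 20, 21, 22]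
    else if a = 12 then [3, 4, 5, 9, 10, 24, 25, 27]
    else if a = 13 then [1, 16, 17, 18, 19, 23]
    else if a = 14 then [6, 7, 8, 11, 12, 26, 28]
    else if a = 15 then [1, 16, 17, 18, 19, 23]
    else if a = 16 then [0, 2, 13, 14, 15, 20, 21, 22]
    else if a = 17 then [3, 4, 5, 9, 10, 24, 25, 27]
    else if a = 18 then [0, 2, 13, 14, 15, 20, 21, 22]
    else if a = 19 then [3, 4, 5, 9, 10, 24, 25, 27]
    else if a = 20 then [0, 2, 13, 14, 15, 20, 21, 22]
    else if a = 21 then [0, 2, 13, 14, 15, 20, 21, 22]
    else if a = 22 then [3, 4, 5, 9, 10, 24, 25, 27]
    else if a = 23 then [3, 4, 5, 9, 10, 24, 25, 27]
    else if a = 24 then [6, 7, 8, 11, 12, 26, 28]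
    else if a = 25 then [6, 7, 8, 11, 12, 26, 28]
    else if a = 26 then [3, 4, 5, 9, 10, 24, 25, 27]
    else if a = 27 then [3, 4, 5, 9, 10, 24, 25, 27]
    else if a = 28 then [3, 4, 5, 9, 10, 24, 25, 27]
    else [])"

definition tab5 :: ranked where
  "tab5 a = (if a = 0 then [(2,1,0,1), (2,16,15,2), (2,17,15,2), (2,18,14,2), (2,19,14,2), (2,23,13,0),
        (10,1,0,1), (10,16,15,2), (10,17,15,2), (10,18,14,2), (10,19,14,2), (10,23,13,0)]
    else if a = 1 then [(0,14,23,0), (0,20,17,1), (0,20,19,1), (0,21,16,1), (0,21,18,1), (12,0,10,1),
        (12,14,27,1)]
    else if a = 2 then [(11,0,2,1), (11,13,21,0), (11,14,22,1), (11,15,20,3), (11,22,13,1)]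
    else if a = 3 then [(2,1,0,1), (2,16,15,1), (2,17,15,1), (2,18,14,1), (2,19,14,1), (2,23,13,1),
        (10,1,0,4), (10,16,15,0), (10,17,15,0), (10,18,14,0), (10,19,14,0), (10,23,13,0)]
    else if a = 4 then [(12,6,5,4), (12,7,4,1), (12,8,4,1), (12,11,3,1), (12,12,3,1), (12,26,25,0),
        (12,28,24,0)]
    else if a = 5 then [(1,1,0,1), (1,16,15,1), (1,17,15,1), (1,18,14,0), (1,19,14,0), (1,23,13,1),
        (9,1,0,1), (9,16,15,1), (9,17,15,1), (9,18,14,0), (9,19,14,0), (9,23,13,1)]
    else if a = 6 then [(5,14,23,1), (5,20,17,2), (5,20,19,0), (5,21,16,2), (5,21,18,0)]
    else if a = 7 then [(4,2,11,2), (4,22,28,0)]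
    else if a = 8 then [(4,4,12,1), (4,9,8,1), (4,10,6,3), (4,10,7,2), (4,27,26,0)]
    else if a = 9 then [(8,0,10,2), (8,14,27,0)]
    else if a = 10 then [(6,0,2,1), (6,13,21,0), (6,14,22,1), (6,15,20,0), (6,22,13,1), (7,0,2,3),
        (7,13,21,1), (7,14,22,0), (7,15,20,1), (7,22,13,1)]
    else if a = 11 then [(3,14,23,1), (3,20,17,2), (3,20,19,4), (3,21,16,0), (3,21,18,0)]
    else if a = 12 then [(3,5,1,5), (3,24,23,0), (3,25,17,0), (3,25,19,0)]
    else if a = 13 then [(21,1,0,0), (21,16,15,1), (21,17,15,0), (21,18,14,1), (21,19,14,0),
        (21,23,13,0)]
    else if a = 14 then [(22,6,5,4), (22,7,4,1), (22,8,4,1), (22,11,3,0), (22,12,3,0), (22,26,25,3),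
        (22,28,24,0), (23,6,5,0), (23,7,4,1), (23,8,4,1), (23,11,3,2), (23,12,3,2),
        (23,26,25,0), (23,28,24,0), (27,6,5,0), (27,7,4,1), (27,8,4,1), (27,11,3,0),
        (27,12,3,0), (27,26,25,1), (27,28,24,0)]
    else if a = 15 then [(20,1,0,0), (20,16,15,1), (20,17,15,1), (20,18,14,0), (20,19,14,0),
        (20,23,13,1)]
    else if a = 16 then [(15,14,23,1), (15,20,17,2), (15,20,19,0), (15,21,16,2), (15,21,18,0)]
    else if a = 17 then [(15,5,1,0), (15,24,23,2), (15,25,17,2), (15,25,19,0)]
    else if a = 18 then [(14,2,11,0), (14,22,28,0)]
    else if a = 19 then [(14,4,12,0), (14,9,8,1), (14,10,6,0), (14,10,7,2), (14,27,26,0)]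
    else if a = 20 then [(17,0,10,1), (17,14,27,1), (19,0,10,0), (19,14,27,0)]
    else if a = 21 then [(16,0,2,1), (16,13,21,0), (16,14,22,1), (16,15,20,0), (16,22,13,1), (18,0,2,0),
        (18,13,21,1), (18,14,22,0), (18,15,20,1), (18,22,13,1)]
    else if a = 22 then [(13,5,1,2), (13,24,23,2), (13,25,17,2), (13,25,19,2), (28,3,10,0), (28,5,9,3),
        (28,24,27,0)]
    else if a = 23 then [(13,5,1,0), (13,24,23,0), (13,25,17,0), (13,25,19,0), (28,3,10,1), (28,5,9,1),
        (28,24,27,1)]
    else if a = 24 then [(22,6,5,1), (22,7,4,1), (22,8,4,1), (22,11,3,1), (22,12,3,1), (22,26,25,1),
        (22,28,24,1), (23,6,5,0), (23,7,4,1), (23,8,4,1), (23,11,3,1), (23,12,3,2),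
        (23,26,25,0), (23,28,24,1), (27,6,5,0), (27,7,4,1), (27,8,4,1), (27,11,3,1),
        (27,12,3,2), (27,26,25,1), (27,28,24,1)]
    else if a = 25 then [(17,6,5,0), (17,7,4,1), (17,8,4,1), (17,11,3,1), (17,12,3,1), (17,26,25,0),
        (17,28,24,1), (19,6,5,1), (19,7,4,0), (19,8,4,0), (19,11,3,1), (19,12,3,1),
        (19,26,25,1), (19,28,24,1)]
    else if a = 26 then [(25,4,12,1), (25,9,8,0), (25,10,6,0), (25,10,7,0), (25,27,26,0)]
    else if a = 27 then [(26,3,10,0), (26,5,9,0), (26,24,27,0)]
    else if a = 28 then [(24,4,12,1), (24,9,8,2), (24,10,6,0), (24,10,7,2), (24,27,26,0)]
    else [])"

definition tab6 :: table where
  "tab6 a = (if a = 0 then [(2,13,21), (10,13,21)]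
    else if a = 1 then [(0,23,13)]
    else if a = 2 then [(11,21,16), (11,21,18)]
    else if a = 3 then [(10,13,21), (10,14,22), (10,15,20)]
    else if a = 4 then [(12,24,23), (12,25,17), (12,25,19)]
    else if a = 5 then [(1,14,23), (9,14,27)]
    else if a = 6 then [(5,18,14), (5,19,14)]
    else if a = 7 then [(4,28,24)]
    else if a = 8 then [(4,26,25)]
    else if a = 9 then [(8,27,26)]
    else if a = 10 then [(6,20,19), (6,21,18), (7,22,28)]
    else if a = 11 then [(3,16,15), (3,18,14)]
    else if a = 12 then [(3,17,15), (3,19,14), (3,23,13)]
    else if a = 13 then [(21,0,2), (21,13,21), (21,14,22), (21,15,20)]
    else if a = 14 then [(22,3,10), (22,24,27), (23,5,1), (23,24,23), (23,25,17), (23,25,19), (27,3,10),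
        (27,5,9), (27,24,27)]
    else if a = 15 then [(20,0,10), (20,14,27)]
    else if a = 16 then [(15,18,14), (15,19,14)]
    else if a = 17 then [(15,1,0), (15,19,14)]
    else if a = 18 then [(14,11,3), (14,28,24)]
    else if a = 19 then [(14,6,5), (14,12,3), (14,26,25)]
    else if a = 20 then [(19,10,6), (19,27,26)]
    else if a = 21 then [(16,20,19), (16,21,18), (18,2,11), (18,22,28)]
    else if a = 22 then [(28,10,6), (28,27,26)]
    else if a = 23 then [(13,1,0), (13,17,15), (13,19,14), (13,23,13)]
    else if a = 24 then [(23,5,1), (23,25,17), (23,25,19), (27,5,9)]
    else if a = 25 then [(17,5,1), (17,25,19), (19,4,12)]
    else if a = 26 then [(25,6,5), (25,7,4), (25,8,4), (25,26,25)]
    else if a = 27 then [(26,9,8), (26,10,6), (26,10,7), (26,27,26)]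
    else if a = 28 then [(24,6,5), (24,26,25)]
    else [])"

definition tabA :: ranked where
  "tabA a = (if a = 0 then [(2,7,5,0), (3,7,6,1), (4,9,10,0)]
    else if a = 1 then [(2,14,5,0), (3,14,6,0), (4,13,10,0)]
    else if a = 2 then [(0,5,7,0), (0,5,9,0), (0,8,7,0), (0,8,9,1), (2,5,8,0), (2,8,8,1), (3,5,9,0),
        (3,8,9,1)]
    else if a = 3 then [(1,6,13,0), (1,6,14,1), (1,9,13,0), (1,9,14,0)]
    else if a = 4 then [(2,10,8,0), (3,10,9,0)]
    else if a = 5 then [(7,14,6,0), (8,13,10,0), (9,2,0,0), (9,13,11,0)]
    else if a = 6 then [(13,3,1,0)]
    else if a = 7 then [(5,6,13,0), (5,6,14,1), (5,9,13,0), (5,9,14,0)]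
    else if a = 8 then [(7,10,9,0)]
    else if a = 9 then [(10,0,2,0), (10,11,13,0), (10,11,14,1), (11,0,3,1), (13,0,4,0), (14,0,2,0),
        (14,11,13,0)]
    else if a = 10 then [(7,14,6,1), (8,13,10,0), (9,2,0,0), (9,13,11,0)]
    else if a = 11 then [(13,3,1,0)]
    else if a = 12 then []
    else if a = 13 then [(10,1,2,0), (10,4,2,0), (11,1,3,0), (11,4,3,0), (13,1,4,0), (13,4,4,1),
        (14,1,2,0), (14,4,2,0)]
    else if a = 14 then [(5,2,2,0), (5,13,13,0), (5,13,14,0), (6,2,3,0)]
    else [])"

definition tabC :: ranked where
  "tabC a = (if a = 0 then [(0,8,7,0), (0,8,8,1), (1,8,7,0), (2,7,14,0), (3,7,15,0), (16,8,17,1)]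
    else if a = 1 then [(11,7,4,0), (12,7,5,0), (12,7,6,1), (13,7,6,1)]
    else if a = 2 then [(11,14,4,0), (12,14,5,0), (12,14,6,1), (13,14,6,1)]
    else if a = 3 then [(0,15,7,0), (0,15,8,0), (1,15,7,2), (16,15,17,1)]
    else if a = 4 then [(4,8,7,0), (4,8,8,1), (5,8,9,0), (6,7,15,0), (14,8,10,1)]
    else if a = 5 then [(7,9,10,0), (7,13,11,0), (9,13,12,1)]
    else if a = 6 then [(4,15,7,0), (4,15,8,0), (5,15,9,3), (14,15,10,0)]
    else if a = 7 then [(4,10,7,0), (4,10,8,0), (5,2,13,2), (5,10,9,0), (5,11,13,0), (14,2,11,0),
        (14,10,10,0), (14,11,11,0), (15,2,12,0), (15,11,12,0)]
    else if a = 8 then [(7,1,11,0), (9,1,12,0)]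
    else if a = 9 then [(7,3,2,1), (7,12,2,1), (8,3,1,1), (8,12,1,1), (9,3,3,1), (9,12,3,1), (10,3,0,0),
        (10,12,0,0), (18,3,16,1), (18,12,16,1)]
    else if a = 10 then [(7,0,2,0), (8,0,1,0), (9,0,3,0), (10,0,0,0), (18,0,16,1)]
    else if a = 11 then [(11,4,4,0), (12,4,5,0), (12,4,6,0), (13,4,6,0)]
    else if a = 12 then [(0,5,7,0), (0,5,8,1), (1,5,7,0), (2,6,14,0), (3,6,15,1), (16,5,17,1)]
    else if a = 13 then [(11,6,4,0), (12,6,5,2), (12,6,6,1), (13,6,6,1)]
    else if a = 14 then [(4,10,7,0), (4,10,8,0), (5,10,9,0), (5,11,13,0), (14,10,10,1), (14,11,11,1),
        (15,11,12,1)]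
    else if a = 15 then [(7,12,2,0), (8,12,1,0), (9,12,3,2), (10,12,0,0), (18,12,16,1)]
    else if a = 16 then [(11,17,4,1), (12,17,5,1), (12,17,6,1), (13,17,6,1)]
    else if a = 17 then []
    else if a = 18 then [(5,16,13,1), (14,16,11,1), (15,16,12,1)]
    else [])"

definition word1 :: "nat \<Rightarrow> nat list" where
  "word1 a = (if a = 0 then [2, 11, 3]
    else if a = 1 then [9, 8, 4, 12, 3]
    else if a = 2 then [10, 6, 5, 1, 0]
    else if a = 3 then [10, 6, 5]
    else if a = 4 then [10, 7, 4, 12, 3]
    else if a = 5 then [20, 19, 14, 23, 13]
    else if a = 6 then [20, 19, 14]
    else if a = 7 then [21, 16, 15]
    else if a = 8 then [21, 18, 14, 23, 13]
    else if a = 9 then [21, 18, 14]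
    else if a = 10 then [22, 28, 24, 23, 13]
    else if a = 11 then [22, 28, 24]
    else if a = 12 then [27, 26, 25, 19, 14, 23, 13]
    else if a = 13 then [27, 26, 25, 19, 14]
    else if a = 14 then [27, 26, 25, 17, 15]
    else [])"

definition word2 :: "nat \<Rightarrow> nat list" where
  "word2 a = (if a = 0 then [0, 7, 9]
    else if a = 1 then [0, 7, 6]
    else if a = 2 then [0, 9, 11]
    else if a = 3 then [0, 9]
    else if a = 4 then [1, 14, 13]
    else if a = 5 then [1, 14]
    else if a = 6 then [1, 13]
    else if a = 7 then [2, 5, 13]
    else if a = 8 then [2, 5, 14]
    else if a = 9 then [2, 5]
    else if a = 10 then [2, 8, 10]
    else if a = 11 then [3, 9, 11]
    else if a = 12 then [3, 9]
    else if a = 13 then [3, 6]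
    else if a = 14 then [4, 10, 13]
    else if a = 15 then [4, 10]
    else if a = 16 then [0, 7, 9, 11]
    else if a = 17 then [2, 5, 14, 13]
    else if a = 18 then [2, 8, 10, 13]
    else [])"

definition word3 :: "nat \<Rightarrow> nat list" where
  "word3 a = (if a = 0 then [3, 15]
    else if a = 1 then [13, 6, 15]
    else if a = 2 then [12, 5, 9]
    else if a = 3 then [12, 5]
    else if a = 4 then [12, 6, 15]
    else if a = 5 then [1, 7, 10]
    else if a = 6 then [1, 7]
    else if a = 7 then [0, 8]
    else if a = 8 then [0, 7, 10]
    else if a = 9 then [0, 7]
    else if a = 10 then [2, 14, 10]
    else if a = 11 then [2, 14]
    else if a = 12 then [11, 4, 7, 10]
    else if a = 13 then [11, 4, 7]
    else if a = 14 then [11, 4, 8]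
    else [])"

definition start1 :: "nat \<Rightarrow> bool" where "start1 a \<longleftrightarrow> a \<in> set [2, 9, 10, 20, 21, 22, 27]"

definition start2 :: "nat \<Rightarrow> bool" where "start2 a \<longleftrightarrow> a \<in> set [0, 1, 2, 3, 4]"

definition start3 :: "nat \<Rightarrow> bool" where "start3 a \<longleftrightarrow> a \<in> set [0, 1, 2, 3, 11, 12, 13]"

definition letters5 :: "nat list" where "letters5 = [0, 1, 2, 3, 4, 5, 6, 7, 8, 9, 10, 11, 12, 13, 14, 15, 16, 17, 18, 19, 20, 21, 22, 23, 24, 25, 26, 27, 28]"
definition lettersA :: "nat list" where "lettersA = [0, 1, 2, 3, 4, 5, 6, 7, 8, 9, 10, 11, 12, 13, 14]"
definition lettersC :: "nat list" where "lettersC = [0, 1, 2, 3, 4, 5, 6, 7, 8, 9, 10, 11, 12, 13, 14, 15, 16, 17, 18]"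

definition blocksA :: table where "blocksA = kept tabA"
definition blocksC :: table where "blocksC = flip_table (kept tabC)"

section \<open>Evaluation of the tables\<close>

text \<open>With the weak congruences the simplifier evaluates by value: branches of conditionals and bodies of
  abstractions are left alone until they are needed.\<close>

lemma list_all_weak_cong: "xs = ys \<Longrightarrow> list_all P xs = list_all P ys" by simp
lemma list_ex_weak_cong: "xs = ys \<Longrightarrow> list_ex P xs = list_ex P ys" by simp
lemma map_weak_cong: "xs = ys \<Longrightarrow> map f xs = map f ys" by simp
lemma case_prod_weak_cong: "p = q \<Longrightarrow> case_prod f p = case_prod f q" by simp
lemma walk_weak_cong:
  "a = a' \<Longrightarrow> c = c' \<Longrightarrow> u = u' \<Longrightarrow> v = v' \<Longrightarrow> walk f s k u v a c Q = walk f s k u' v' a' c' Q" by simp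
lemma list_all_eval: "list_all P [] = True" "list_all P (x # xs) = (if P x then list_all P xs else False)" by simp_all
lemma list_ex_eval: "list_ex P [] = False" "list_ex P (x # xs) = (if P x then True else list_ex P xs)" by simp_all
lemma mem_eval: "(x \<in> set []) = False" "(x \<in> set (y # ys)) = (if x = y then True else x \<in> set ys)" by simp_all
lemma pair_eval: "((a, b) = (c, d)) = (if a = c then b = d else False)" by simp
lemma cons_eval: "(x # xs = []) = False" "([] = x # xs) = False" "(x # xs = y # ys) = (if x = y then xs = ys else False)" by simp_all
lemmas nat_eval = eq_num_simps le_num_simps less_num_simps numeral_eq_iff numeral_less_iff
  zero_neq_numeral numeral_neq_zero zero_neq_one one_neq_zero numeral_eq_one_iff one_eq_numeral_iff
  zero_less_numeral zero_less_one one_less_numeral_iff less_nat_zero_code not_numeral_less_one less_numeral_extra refl[THEN eqTrueI]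
lemmas eval = nat_eval if_True if_False simp_thms prod.case list_all_eval list_ex_eval mem_eval pair_eval cons_eval
  append.simps list.map concat.simps quads.simps image_blocks.simps walk.simps hits_start.simps index.simps
lemmas eval_cong = if_weak_cong list_all_weak_cong list_ex_weak_cong map_weak_cong case_prod_weak_cong walk_weak_cong

lemma tab_letters:
  "tab5 a \<noteq> [] \<Longrightarrow> a \<in> set letters5" "tab6 a \<noteq> [] \<Longrightarrow> a \<in> set letters5"
  "tabA a \<noteq> [] \<Longrightarrow> a \<in> set lettersA" "tabC a \<noteq> [] \<Longrightarrow> a \<in> set lettersC"
  unfolding tab5_def tab6_def tabA_def tabC_def letters5_def lettersA_def lettersC_def
  by (simp_all split: if_splits)

lemma kept_letters: "(kept F a \<noteq> []) \<Longrightarrow> F a \<noteq> []" "(flip_table f a \<noteq> []) \<Longrightarrow> f a \<noteq> []"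
  by (auto simp: kept_def flip_table_def)

lemma tab5_complete: "list_all (\<lambda>a. list_all (\<lambda>b. list_all (\<lambda>c. list_all (\<lambda>d. if d \<in> set (v_succ b)
      then (b, c, d) \<in> set (forget tab5 a) else True) (h_succ c)) (v_succ a)) (h_succ a)) letters5"
  by (simp only: eval letters5_def h_succ_def v_succ_def forget_def tab5_def cong: eval_cong)

lemma tab5_prunable: "list_all (\<lambda>a. list_all (prunable tab5 letters5 a) (tab5 a)) letters5"
  by (simp only: eval letters5_def prunable_def tab5_def cong: eval_cong)

text \<open>A 2 by 2 block of the sheared configuration lies in two horizontally adjacent blocks of
  the original one. The letters \<open>z\<close> and \<open>e\<close> are those it does not
  see.\<close>

lemma tab6_complete: "list_all (\<lambda>a. list_all (\<lambda>(b, z, c). list_all (\<lambda>(e, c', d). if c' = c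
      then (b, c, d) \<in> set (tab6 a) else True) (kept tab5 b)) (kept tab5 a)) letters5"
  by (simp only: eval letters5_def kept_def tab5_def tab6_def cong: eval_cong)

text \<open>In a sheared block \<open>b\<close> is the right neighbour of \<open>a\<close>, and
  \<open>c\<close> lies above \<open>b\<close> in the original coordinates. These adjacencies
  suffice to turn a legal configuration back into a tiling.\<close>

lemma tab6_sound: "list_all (\<lambda>a. list_all (\<lambda>(b, c, d). if b \<in> set (h_succ a) then c \<in> set (v_succ b) else False) (tab6 a)) letters5"
  by (simp only: eval letters5_def tab6_def h_succ_def v_succ_def cong: eval_cong)

text \<open>The fuel is one more than the length of the longest word, here and in
  \<open>slicing2\<close> and \<open>slicing3\<close>. It is written with \<open>Suc\<close> so that
  the equations of \<open>walk\<close> and \<open>hits_start\<close> apply directly.\<close>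

lemma slicing1: "slicing_check tab6 letters5 start1 (Suc (Suc (Suc (Suc (Suc (Suc (Suc (Suc 0)))))))) word1 (index word1 lettersA) (forget tabA)"
  by (simp only: eval letters5_def lettersA_def slicing_check_def tab6_def start1_def word1_def forget_def tabA_def cong: eval_cong)

lemma tabA_prunable: "list_all (\<lambda>a. list_all (prunable tabA lettersA a) (tabA a)) lettersA"
  by (simp only: eval lettersA_def prunable_def tabA_def cong: eval_cong)

lemma slicing2: "slicing_check (flip_table (kept tabA)) lettersA start2 (Suc (Suc (Suc (Suc (Suc 0))))) word2 (index word2 lettersC) (forget tabC)"
  by (simp only: eval lettersA_def lettersC_def slicing_check_def kept_def flip_table_def tabA_def start2_def word2_def forget_def tabC_def cong: eval_cong)

lemma tabC_prunable: "list_all (\<lambda>a. list_all (prunable tabC lettersC a) (tabC a)) lettersC"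
  by (simp only: eval lettersC_def prunable_def tabC_def cong: eval_cong)

lemma slicing3: "slicing_check (flip_table (kept tabC)) lettersC start3 (Suc (Suc (Suc (Suc (Suc 0))))) word3 (index word3 lettersA) (forget tabA)"
  by (simp only: eval lettersA_def lettersC_def slicing_check_def kept_def flip_table_def tabA_def start3_def word3_def forget_def tabC_def cong: eval_cong)

lemma img1: "image_check (kept tabA) lettersA word1 tab6"
  by (simp only: eval lettersA_def image_check_def kept_def tabA_def word1_def tab6_def cong: eval_cong)

lemma img2: "image_check (kept tabC) lettersC word2 (flip_table (kept tabA))"
  by (simp only: eval lettersC_def image_check_def kept_def flip_table_def tabA_def word2_def tabC_def cong: eval_cong)

lemma img3: "image_check (kept tabA) lettersA word3 (flip_table (kept tabC))"
  by (simp only: eval lettersA_def image_check_def kept_def flip_table_def tabA_def word3_def tabC_def cong: eval_cong)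


section \<open>Which blocks force which other blocks\<close>

fun flip_block :: "'a \<times> 'a \<times> 'a \<times> 'a \<Rightarrow> 'a \<times> 'a \<times> 'a \<times> 'a" where "flip_block (a, b, c, d) = (a, c, b, d)"

text \<open>The words of \<open>word2\<close> are vertical, so a block is flipped before it is
  expanded. The results are transposed blocks of A, which are flipped back before
  \<open>word3\<close> expands them.\<close>

definition descendants :: "nat \<times> nat \<times> nat \<times> nat \<Rightarrow> (nat \<times> nat \<times> nat \<times> nat) list" where
  "descendants q = concat (map (\<lambda>m. image_blocks word3 (flip_block m)) (image_blocks word2 (flip_block q)))"

definition "hub = (5 :: nat, 9 :: nat, 7 :: nat, 10 :: nat)"
text \<open>\<open>orphan\<close> is the only block of \<open>blocksC\<close> which is in the image of no block, hence it never occurs. The other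
  blocks are descendants of \<open>hub\<close> in two generations, through \<open>spokes\<close>.\<close>

definition "orphan = (14 :: nat, 10 :: nat, 4 :: nat, 8 :: nat)"
definition "spokes = [(0 :: nat, 7 :: nat, 2 :: nat, 14 :: nat), (7, 10, 4, 7), (8, 1, 9, 12), (13, 6, 11, 4),
  (9, 12, 10, 0), (7, 10, 14, 10), (11, 4, 12, 5)]"

lemma hub: "list_all (\<lambda>a. list_all (\<lambda>(c, b, d). if hub \<in> set (descendants (a, b, c, d)) then True
    else list_ex (\<lambda>q. hub \<in> set (descendants q)) (descendants (a, b, c, d))) (kept tabC a)) lettersC"
  by (simp only: eval lettersC_def kept_def tabC_def descendants_def flip_block.simps word2_def word3_def hub_def cong: eval_cong)

text \<open>Lets \<open>hub\<close> persist, so that blocks which reach it after one generation also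
  reach it after two.\<close>

lemma hub_self: "hub \<in> set (descendants hub)"
  by (simp only: eval descendants_def flip_block.simps word2_def word3_def hub_def cong: eval_cong)

lemma spokes: "list_all (\<lambda>q. q \<in> set (descendants hub)) spokes"
  by (simp only: eval descendants_def flip_block.simps word2_def word3_def hub_def spokes_def cong: eval_cong)

lemma spokes_cover: "list_all (\<lambda>a. list_all (\<lambda>(c, b, d). if (a, b, c, d) = orphan then True
    else list_ex (\<lambda>q. (a, b, c, d) \<in> set (descendants q)) spokes) (kept tabC a)) lettersC"
  by (simp only: eval lettersC_def kept_def tabC_def descendants_def flip_block.simps word2_def word3_def hub_def spokes_def orphan_def cong: eval_cong)

lemma orphan: "list_all (\<lambda>a. list_all (\<lambda>(c, b, d). if orphan \<in> set (descendants (a, b, c, d)) then False else True) (kept tabC a)) lettersC"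
  by (simp only: eval lettersC_def kept_def tabC_def descendants_def flip_block.simps word2_def word3_def orphan_def cong: eval_cong)

section \<open>Descent and repetitivity\<close>

lemma block_transposed: "block (transposed x) m n = flip_block (block x n m)"
  by (simp add: block_def)

lemma flip_block_twice [simp]: "flip_block (flip_block q) = q"
  by (cases q) simp

lemma word_long: "word2 a \<noteq> [] \<Longrightarrow> 2 \<le> length (word2 a)" "word3 a \<noteq> [] \<Longrightarrow> 2 \<le> length (word3 a)"
  by (simp_all add: word2_def word3_def split: if_splits)

lemma desubst1:
  assumes "x \<in> legal tab6"
  obtains y c where "y \<in> legal blocksA" "slicing word1 x y c" "recognizable x y c"
proof -
  obtain y c where y: "y \<in> legal (forget tabA)" and c: "slicing word1 x y c" "recognizable x y c"
    using slicing_exists[OF assms tab_letters(2) slicing1] by blast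
  have "y \<in> legal blocksA"
    unfolding blocksA_def by (rule prune[OF y tab_letters(3) tabA_prunable])
  then show ?thesis using that c by blast
qed

lemma desubst2:
  assumes "x \<in> legal blocksA"
  obtains y c where "y \<in> legal blocksC" "slicing word2 (transposed x) (transposed y) c" "recognizable (transposed x) (transposed y) c"
proof -
  have "transposed x \<in> legal (flip_table (kept tabA))"
    using assms legal_flip_iff unfolding blocksA_def by blast
  then obtain y c where y: "y \<in> legal (forget tabC)" and c: "slicing word2 (transposed x) y c" "recognizable (transposed x) y c"
    using slicing_exists[OF _ _ slicing2] kept_letters tab_letters(3) by metis
  have "y \<in> legal (kept tabC)"
    by (rule prune[OF y tab_letters(4) tabC_prunable])
  then have "transposed y \<in> legal blocksC"
    unfolding blocksC_def by (rule legal_flip)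
  then show ?thesis using that[of "transposed y" c] c by simp
qed

lemma desubst3:
  assumes "x \<in> legal blocksC"
  obtains y c where "y \<in> legal blocksA" "slicing word3 x y c" "recognizable x y c"
proof -
  obtain y c where y: "y \<in> legal (forget tabA)" and c: "slicing word3 x y c" "recognizable x y c"
    using slicing_exists[OF _ _ slicing3] kept_letters tab_letters(4) assms unfolding blocksC_def by metis
  have "y \<in> legal blocksA"
    unfolding blocksA_def by (rule prune[OF y tab_letters(3) tabA_prunable])
  then show ?thesis using that c by blast
qed

lemma desubst:
  assumes "x \<in> legal blocksC"
  obtains a z c d where "z \<in> legal blocksC" "slicing word3 x a c" "recognizable x a c"
    "slicing word2 (transposed a) (transposed z) d" "recognizable (transposed a) (transposed z) d"
proof -
  obtain a c where a: "a \<in> legal blocksA" "slicing word3 x a c" "recognizable x a c" using desubst3[OF assms] .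
  obtain z d where "z \<in> legal blocksC" "slicing word2 (transposed a) (transposed z) d" "recognizable (transposed a) (transposed z) d"
    using desubst2[OF a(1)] .
  then show ?thesis using that a by blast
qed

lemma descendants_occur:
  assumes x: "slicing word3 x a c" and a: "slicing word2 (transposed a) (transposed z) d"
    and "\<exists>i j. block z i j = q" "q' \<in> set (descendants q)"
  shows "\<exists>m n. block x m n = q'"
proof -
  obtain r where r: "r \<in> set (image_blocks word2 (flip_block q))" "q' \<in> set (image_blocks word3 (flip_block r))"
    using assms(4) by (auto simp: descendants_def)
  obtain i j where "block z i j = q" using assms(3) by blast
  then have "r \<in> set (image_blocks word2 (block (transposed z) j i))" using r(1) by (simp add: block_transposed)
  then obtain n where "block (transposed a) n i = r" using image_blocks_slicing[OF a] by blast
  then have "block a i n = flip_block r" by (metis block_transposed flip_block_twice)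
  then have "q' \<in> set (image_blocks word3 (block a i n))" using r(2) by simp
  then show ?thesis using image_blocks_slicing[OF x] by blast
qed

lemma descendants_cover:
  assumes x: "slicing word3 x a c" and a: "slicing word2 (transposed a) (transposed z) d"
  shows "\<exists>i j. block x m n \<in> set (descendants (block z i j))"
proof -
  obtain i where i: "c i \<le> m" "m < c (i + 1)" using grid_cell[of c m] slicingD(1)[OF x] by blast
  obtain j where j: "d j \<le> n" "n < d (j + 1)" using grid_cell[of d n] slicingD(1)[OF a] by blast
  have "block (transposed a) n i \<in> set (image_blocks word2 (block (transposed z) j i))" by (rule slicing_image_blocks[OF a j])
  then have "flip_block (block a i n) \<in> set (image_blocks word2 (flip_block (block z i j)))" by (simp add: block_transposed)
  moreover have "block x m n \<in> set (image_blocks word3 (flip_block (flip_block (block a i n))))" using slicing_image_blocks[OF x i] by simp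
  ultimately have "block x m n \<in> set (descendants (block z i j))" unfolding descendants_def set_concat set_map by blast
  then show ?thesis by blast
qed

lemma blocksC_cases:
  assumes "x \<in> legal blocksC" and chk: "list_all (\<lambda>a. list_all (\<lambda>(c, b, d). P (a, b, c, d)) (kept tabC a)) lettersC"
  shows "P (block x m n)"
proof -
  have "(x (m + 1, n), x (m, n + 1), x (m + 1, n + 1)) \<in> set (blocksC (x (m, n)))"
    by (rule legalD[OF assms(1)])
  then have *: "(x (m, n + 1), x (m + 1, n), x (m + 1, n + 1)) \<in> set (kept tabC (x (m, n)))"
    by (auto simp: blocksC_def flip_table_def)
  then have "kept tabC (x (m, n)) \<noteq> []" by auto
  then have "x (m, n) \<in> set lettersC" by (rule tab_letters(4)[OF kept_letters(1)])
  from bspec[OF bspec[OF chk[unfolded list_all_iff] this] *] show ?thesis by (simp add: block_def)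
qed

lemma hub_occurs:
  assumes "x \<in> legal blocksC"
  shows "\<exists>m n. block x m n = hub"
proof -
  obtain a z c d where z: "z \<in> legal blocksC" and 1: "slicing word3 x a c" "slicing word2 (transposed a) (transposed z) d"
    using desubst[OF assms] by metis
  obtain a' z' c' d' where z': "z' \<in> legal blocksC" and 2: "slicing word3 z a' c'" "slicing word2 (transposed a') (transposed z') d'"
    using desubst[OF z] by metis
  have "if hub \<in> set (descendants (block z' 0 0)) then True else list_ex (\<lambda>q. hub \<in> set (descendants q)) (descendants (block z' 0 0))"
    by (rule blocksC_cases[OF z' hub, of 0 0])
  then consider "hub \<in> set (descendants (block z' 0 0))" | q where "q \<in> set (descendants (block z' 0 0))" "hub \<in> set (descendants q)"
    by (auto simp: list_ex_iff split: if_splits)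
  then show ?thesis
  proof cases
    case 1
    then have "\<exists>m n. block z m n = hub" using descendants_occur[OF 2] by blast
    then show ?thesis using descendants_occur[OF \<open>slicing word3 x a c\<close> \<open>slicing word2 (transposed a) (transposed z) d\<close>] hub_self by blast
  next
    case (2 q)
    then have "\<exists>m n. block z m n = q" using descendants_occur[OF \<open>slicing word3 z a' c'\<close> \<open>slicing word2 (transposed a') (transposed z') d'\<close>] by blast
    then show ?thesis using descendants_occur[OF 1] 2(2) by blast
  qed
qed

text \<open>The block of \<open>x\<close> descends from a spoke, and spokes descend from
  \<open>hub\<close>. Two generations above \<open>x'\<close> there is a configuration containing
  \<open>hub\<close>, so the block comes down to \<open>x'\<close>. No spoke is required for
  \<open>orphan\<close>, because \<open>x\<close> is itself an image and avoids it.\<close>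

lemma blocks_occur:
  assumes x: "x \<in> legal blocksC" and x': "x' \<in> legal blocksC"
  shows "\<exists>m' n'. block x' m' n' = block x m n"
proof -
  have "block x m n \<noteq> orphan"
  proof -
    obtain a z c d where z: "z \<in> legal blocksC" and 1: "slicing word3 x a c" "slicing word2 (transposed a) (transposed z) d"
      using desubst[OF x] by metis
    obtain i j where "block x m n \<in> set (descendants (block z i j))" using descendants_cover[OF 1] by blast
    moreover have "if orphan \<in> set (descendants (block z i j)) then False else True"
      by (rule blocksC_cases[OF z orphan])
    ultimately show ?thesis by (auto split: if_splits)
  qed
  moreover have "if block x m n = orphan then True else list_ex (\<lambda>q. block x m n \<in> set (descendants q)) spokes"
    by (rule blocksC_cases[OF x spokes_cover])
  ultimately obtain q where q: "q \<in> set spokes" "block x m n \<in> set (descendants q)"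
    by (auto simp: list_ex_iff split: if_splits)
  then have "q \<in> set (descendants hub)" using spokes by (simp add: list_all_iff)
  obtain a z c d where z: "z \<in> legal blocksC" and 1: "slicing word3 x' a c" "slicing word2 (transposed a) (transposed z) d"
    using desubst[OF x'] by metis
  obtain a' z' c' d' where z': "z' \<in> legal blocksC" and 2: "slicing word3 z a' c'" "slicing word2 (transposed a') (transposed z') d'"
    using desubst[OF z] by metis
  have "\<exists>m n. block z m n = q"
    by (rule descendants_occur[OF 2 hub_occurs[OF z'] \<open>q \<in> set (descendants hub)\<close>])
  from descendants_occur[OF 1 this q(2)] show ?thesis .
qed

section \<open>Windows of every size, and periods\<close>

lemma occurs_trivial: "l \<le> 0 \<or> h \<le> 0 \<Longrightarrow> occurs l h x x'"
  unfolding occurs_def by (elim disjE) simp_all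

lemma occurs_22:
  assumes "\<And>m n. \<exists>m' n'. block x' m' n' = block x m n"
  shows "occurs 2 2 x x'"
  unfolding occurs_def
proof (intro allI)
  fix a b
  obtain a' b' where eq: "block x' a' b' = block x a b" using assms by blast
  have "x (a + s, b + t) = x' (a' + s, b' + t)" if "s \<in> {0..<2}" "t \<in> {0..<2}" for s t :: int
  proof -
    have "s = 0 \<or> s = 1" "t = 0 \<or> t = 1" using that by auto
    then show ?thesis using eq by (auto simp: block_def)
  qed
  then show "\<exists>a' b'. \<forall>s\<in>{0..<2}. \<forall>t\<in>{0..<2}. x (a + s, b + t) = x' (a' + s, b' + t)" by blast
qed

text \<open>Sizes 1 and 2 stay fixed, out of reach of \<open>slicing_cover2\<close>. Larger sizes
  drop by one, so the sum of both sides can serve as induction measure.\<close>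

lemma slicing_shrink:
  assumes "slicing w x y c" "\<And>a. w a \<noteq> [] \<Longrightarrow> 2 \<le> length (w a)" "0 < l"
  shows "\<exists>i. c i \<le> a \<and> a + l \<le> c (i + (if 3 \<le> l then l - 1 else l))"
proof (cases "3 \<le> l")
  case True
  have "\<And>n i. 2 \<le> length (w (y (i, n)))" using assms(1,2) unfolding slicing_def by blast
  from slicing_cover2[OF assms(1) this True] True show ?thesis by simp
next
  case False
  then show ?thesis using slicing_cover[OF assms(1,3)] by simp
qed

lemma occurs_blocksC:
  assumes "x \<in> legal blocksC" "x' \<in> legal blocksC"
  shows "occurs l h x x'"
  using assms
proof (induction "nat l + nat h" arbitrary: l h x x' rule: less_induct)
  case less
  show ?case
  proof (cases "l \<le> 2 \<and> h \<le> 2")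
    case True
    then show ?thesis using occurs_mono[OF occurs_22] blocks_occur[OF less.prems] by blast
  next
    case large: False
    show ?thesis
    proof (cases "l \<le> 0 \<or> h \<le> 0")
      case True then show ?thesis by (rule occurs_trivial)
    next
      case False
      then have pos: "0 < l" "0 < h" by auto
      let ?l = "if 3 \<le> l then l - 1 else l" and ?h = "if 3 \<le> h then h - 1 else h"
      obtain a z c d where z: "z \<in> legal blocksC" and x: "slicing word3 x a c" "slicing word2 (transposed a) (transposed z) d"
        using desubst[OF less.prems(1)] by metis
      obtain a' z' c' d' where z': "z' \<in> legal blocksC" and x': "slicing word3 x' a' c'" "slicing word2 (transposed a') (transposed z') d'"
        using desubst[OF less.prems(2)] by metis
      have "nat ?l + nat ?h < nat l + nat h" using large pos by auto
      then have "occurs ?l ?h z z'" using less.hyps z z' by blast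
      then have "occurs ?h ?l (transposed z) (transposed z')" by (simp only: occurs_transposed)
      then have "occurs h ?l (transposed a) (transposed a')"
        by (rule occurs_slicing[OF x(2) x'(2)]) (rule slicing_shrink[OF x(2) word_long(1) pos(2)])
      then have "occurs ?l h a a'" by (simp only: occurs_transposed)
      then show "occurs l h x x'"
        by (rule occurs_slicing[OF x(1) x'(1)]) (rule slicing_shrink[OF x(1) word_long(2) pos(1)])
    qed
  qed
qed

lemma grid_half:
  assumes "\<And>i. c i + 2 \<le> c (i + 1)" "c (0 + q) = c 0 + p"
  shows "2 * \<bar>q\<bar> \<le> \<bar>p :: int\<bar>"
  using grid_le[of c 2 0 q, OF assms(1)] grid_le[of c 2 q 0, OF assms(1)] assms(2) by (cases "0 \<le> q") auto

lemma period_blocksC: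
  assumes "x \<in> legal blocksC" "shift p x = x"
  shows "p = 0"
  using assms
proof (induction "nat \<bar>fst p\<bar> + nat \<bar>snd p\<bar>" arbitrary: p x rule: less_induct)
  case less
  obtain a z c d where z: "z \<in> legal blocksC" and x: "slicing word3 x a c" "recognizable x a c"
    "slicing word2 (transposed a) (transposed z) d" "recognizable (transposed a) (transposed z) d"
    using desubst[OF less.prems(1)] by metis
  obtain q1 where q1: "\<And>i. c (i + q1) = c i + fst p" "shift (q1, snd p) a = a"
    using x(2) less.prems(2) unfolding recognizable_def by blast
  then have "shift (snd p, q1) (transposed a) = transposed a" by (simp add: shift_transposed)
  then obtain q2 where q2: "\<And>i. d (i + q2) = d i + snd p" "shift (q2, q1) (transposed z) = transposed z"
    using x(4) unfolding recognizable_def by (metis fst_conv snd_conv)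
  then have "transposed (shift (q1, q2) z) = transposed z" by (simp add: shift_transposed)
  then have zq: "shift (q1, q2) z = z" by (metis transposed_transposed)
  have l3: "2 \<le> int (length (word3 (a (i, n))))" for i n
    using x(1) word_long(2)[of "a (i, n)"] unfolding slicing_def by fastforce
  have l2: "2 \<le> int (length (word2 (transposed z (i, n))))" for i n
    using x(3) word_long(1)[of "transposed z (i, n)"] unfolding slicing_def by fastforce
  have h: "2 * \<bar>q1\<bar> \<le> \<bar>fst p\<bar>" "2 * \<bar>q2\<bar> \<le> \<bar>snd p\<bar>"
    by (rule grid_half[OF slicing_step[OF x(1) l3] q1(1)]) (rule grid_half[OF slicing_step[OF x(3) l2] q2(1)])
  show ?case
  proof (rule ccontr)
    assume "p \<noteq> 0"
    then have "fst p \<noteq> 0 \<or> snd p \<noteq> 0" by (simp add: prod_eq_iff)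
    then have "0 < \<bar>fst p\<bar> + \<bar>snd p\<bar>" by auto
    moreover have "2 * (\<bar>q1\<bar> + \<bar>q2\<bar>) \<le> \<bar>fst p\<bar> + \<bar>snd p\<bar>" using h by simp
    ultimately have "nat (\<bar>q1\<bar> + \<bar>q2\<bar>) < nat (\<bar>fst p\<bar> + \<bar>snd p\<bar>)" by simp
    then have "nat \<bar>q1\<bar> + nat \<bar>q2\<bar> < nat \<bar>fst p\<bar> + nat \<bar>snd p\<bar>" by (simp add: nat_add_distrib)
    then have "(q1, q2) = 0" using less.hyps[of "(q1, q2)" z] z zq by simp
    \<comment> \<open>An index shift of 0 leaves the cuts in place, so the original period vanishes
      in both coordinates.\<close>
    then have "fst p = 0" "snd p = 0" using q1(1)[of 0] q2(1)[of 0] by (simp_all add: zero_prod_def)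
    then show False using \<open>fst p \<noteq> 0 \<or> snd p \<noteq> 0\<close> by simp
  qed
qed

section \<open>Existence\<close>

text \<open>Outside a window the configurations below need not be legal, but homogeneity makes the slicing by words
  consistent in the whole plane.\<close>

definition homogeneous :: "nat set \<Rightarrow> (nat \<Rightarrow> nat) \<Rightarrow> (nat \<Rightarrow> nat) \<Rightarrow> nat config \<Rightarrow> bool" where
  "homogeneous S k r y \<longleftrightarrow> (\<forall>i n. y (i, n) \<in> S \<and> k (y (i, n)) = k (y (i, 0)) \<and> r (y (i, n)) = r (y (0, n)))"

lemma homogeneous_transposed: "homogeneous S k r (transposed y) \<longleftrightarrow> homogeneous S r k y"
  unfolding homogeneous_def by simp blast

text \<open>By \<open>st\<close>, letters of equal column type have words with equal sequences of
  column types, in particular of equal length. So the words of one column can be cut in common. Row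
  types are constant along each word and pass to the image.\<close>

lemma homogeneous_inflate:
  assumes y: "homogeneous S k r y"
    and w: "\<And>a. a \<in> S \<Longrightarrow> w a \<noteq> [] \<and> map k' (w a) = st (k a) \<and> (\<forall>b\<in>set (w a). b \<in> S' \<and> r' b = r a)"
  obtains x c where "slicing w x y c" "c 0 = 0" "homogeneous S' k' r' x"
proof -
  have y': "y (i, n) \<in> S" "k (y (i, n)) = k (y (i, 0))" "r (y (i, n)) = r (y (0, n))" for i n
    using y unfolding homogeneous_def by blast+
  have m: "map k' (w (y (i, n))) = st (k (y (i, 0)))" for i n using w[OF y'(1)[of i n]] y'(2)[of i n] by simp
  have "length (w (y (i, n))) = length (w (y (i, 0)))" for i n
    using m[of i n] m[of i 0] by (metis length_map)
  moreover have "w (y (i, n)) \<noteq> []" for i n using w[OF y'(1)] by blast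
  ultimately obtain x c where x: "slicing w x y c" "c 0 = 0" by (rule slicing_ex)
  have "x (m', n) \<in> S' \<and> k' (x (m', n)) = k' (x (m', 0)) \<and> r' (x (m', n)) = r' (x (0, n))" for m' n
  proof -
    have r': "x (m', n) \<in> S' \<and> r' (x (m', n)) = r (y (0, n))" for m'
    proof -
      obtain i where i: "c i \<le> m'" "m' < c (i + 1)" using grid_cell[of c m'] slicingD(1)[OF x(1)] by blast
      have "x (m', n) \<in> set (w (y (i, n)))" using slicing_at[OF x(1) i, of n] by simp
      then show ?thesis using w[OF y'(1)[of i n]] y'(3)[of i n] by simp
    qed
    obtain i where i: "c i \<le> m'" "m' < c (i + 1)" using grid_cell[of c m'] slicingD(1)[OF x(1)] by blast
    have "k' (x (m', n)) = st (k (y (i, 0))) ! nat (m' - c i)" for n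
      using slicing_at[OF x(1) i, of n] m[of i n] by (metis nth_map)
    then show ?thesis using r'[of m'] r'[of 0] by simp
  qed
  then have "homogeneous S' k' r' x" unfolding homogeneous_def by blast
  then show ?thesis using that x by blast
qed

lemma tblocks_flip: "flip_block q \<in> tblocks (flip_table f) \<longleftrightarrow> q \<in> tblocks f"
  by (cases q) (force simp: tblocks_def flip_table_def)

lemma legal_on_transposed: "legal_on (flip_table f) J I (transposed x) \<longleftrightarrow> legal_on f I J x"
  unfolding legal_on_def block_transposed tblocks_flip by blast

lemma legal_on_mono: "legal_on f I J x \<Longrightarrow> I' \<subseteq> I \<Longrightarrow> J' \<subseteq> J \<Longrightarrow> legal_on f I' J' x"
  unfolding legal_on_def by blast

lemma kept_tab_letters: "kept tabA a \<noteq> [] \<Longrightarrow> a \<in> set lettersA" "kept tabC a \<noteq> [] \<Longrightarrow> a \<in> set lettersC"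
  by (rule tab_letters(3)[OF kept_letters(1)], assumption) (rule tab_letters(4)[OF kept_letters(1)])

text \<open>Left out are the letter 12 of A and the letters 16 to 18 of C. They occur in no kept
  block, and their words of length 4 do not fit the types 2 and 3 below.\<close>

definition "usedA = set [0, 1, 2, 3, 4, 5, 6, 7, 8, 9, 10, 11, 13, 14 :: nat]"
definition "usedC = set [0, 1, 2, 3, 4, 5, 6, 7, 8, 9, 10, 11, 12, 13, 14, 15 :: nat]"
text \<open>The type of a column is the width of the words that replace its letters, and the type of
  a row is the height. A letter of C hands its column type to all letters of its vertical word, so
  reading the first one is enough; likewise for \<open>rowA\<close>.\<close>

definition "colA a = length (word3 a)"
definition "colC a = colA (hd (word2 a))"
definition "rowC a = length (word2 a)"
definition "rowA a = rowC (hd (word3 a))"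
text \<open>The substitution 2 -> 23, 3 -> 233 on the types, the same in both directions. Each type
  is the length of its own image, and the matrix is the square of the Fibonacci matrix.\<close>

definition stretch :: "nat \<Rightarrow> nat list" where "stretch t = (if t = 2 then [2, 3] else [2, 3, 3])"

lemma homogeneous_word2:
  "a \<in> usedC \<Longrightarrow> word2 a \<noteq> [] \<and> map rowA (word2 a) = stretch (rowC a) \<and> (\<forall>b\<in>set (word2 a). b \<in> usedA \<and> colA b = colC a)"
  unfolding usedC_def by (simp, elim disjE) (simp_all add: usedA_def stretch_def rowA_def rowC_def colA_def colC_def word2_def word3_def)

lemma homogeneous_word3:
  "a \<in> usedA \<Longrightarrow> word3 a \<noteq> [] \<and> map colC (word3 a) = stretch (colA a) \<and> (\<forall>b\<in>set (word3 a). b \<in> usedC \<and> rowC b = rowA a)"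
  unfolding usedA_def by (simp, elim disjE) (simp_all add: usedC_def stretch_def rowA_def rowC_def colA_def colC_def word2_def word3_def)

lemma length_word1: "a \<in> usedA \<Longrightarrow> length (word1 a) = (if colA a = 2 then 3 else 5)"
  unfolding usedA_def by (simp, elim disjE) (simp_all add: colA_def word1_def word3_def)

lemma slicing_double:
  assumes x: "slicing w x y c" "c 0 = 0" and w: "\<And>a. w a \<noteq> [] \<Longrightarrow> 2 \<le> length (w a)"
  shows "{0..<2 * p} \<subseteq> {m. \<exists>i\<in>{0..<p}. c i \<le> m \<and> m < c (i + 1)}"
proof
  fix m assume m: "m \<in> {0..<2 * p}"
  have l: "2 \<le> int (length (w (y (i, n))))" for i n
    using x(1) w[of "y (i, n)"] unfolding slicing_def by fastforce
  have sm: "strict_mono c" using grid_mono slicingD(1)[OF x(1)] by blast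
  obtain i where i: "c i \<le> m" "m < c (i + 1)" using grid_cell[of c m] slicingD(1)[OF x(1)] by blast
  have "0 \<le> p" using m by simp
  then have "2 * p \<le> c p" using grid_le[of c 2 0 p, OF slicing_step[OF x(1) l]] x(2) by simp
  then have "c i < c p" using i m by simp
  moreover have "c 0 < c (i + 1)" using i m x(2) by simp
  ultimately have "i < p" "0 < i + 1" using strict_mono_less[OF sm] by blast+
  then show "m \<in> {m. \<exists>i\<in>{0..<p}. c i \<le> m \<and> m < c (i + 1)}" using i by (intro CollectI bexI[of _ i]) auto
qed

lemma inflate2:
  assumes y: "homogeneous usedC colC rowC y"
  obtains a c where "slicing word2 (transposed a) (transposed y) c" "c 0 = 0" "homogeneous usedA colA rowA a"
proof -
  have y': "homogeneous usedC rowC colC (transposed y)" using y by (simp add: homogeneous_transposed)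
  obtain a' c where "slicing word2 a' (transposed y) c" "c 0 = 0" "homogeneous usedA rowA colA a'"
    by (rule homogeneous_inflate[OF y' homogeneous_word2])
  then show ?thesis using that[of "transposed a'" c] by (simp add: homogeneous_transposed)
qed

lemma inflate3:
  assumes y: "homogeneous usedA colA rowA y"
  obtains x c where "slicing word3 x y c" "c 0 = 0" "homogeneous usedC colC rowC x"
  by (rule homogeneous_inflate[OF y homogeneous_word3])

lemma legal_on_word2:
  assumes "slicing word2 (transposed a) (transposed y) c" "legal_on blocksC I J y"
  shows "legal_on blocksA I {m. \<exists>i\<in>J. c i \<le> m \<and> m < c (i + 1)} a"
proof -
  have "legal_on (kept tabC) J I (transposed y)"
    using assms(2) legal_on_transposed[of "blocksC" J I y] by (simp add: blocksC_def)
  then have "legal_on (flip_table (kept tabA)) {m. \<exists>i\<in>J. c i \<le> m \<and> m < c (i + 1)} I (transposed a)"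
    using legal_on_slicing[OF img2 kept_tab_letters(2) assms(1)] by blast
  then show ?thesis by (simp only: legal_on_transposed blocksA_def)
qed

lemma legal_on_word3:
  assumes "slicing word3 x a c" "legal_on blocksA I J a"
  shows "legal_on blocksC {m. \<exists>i\<in>I. c i \<le> m \<and> m < c (i + 1)} J x"
  using legal_on_slicing[OF img3 kept_tab_letters(1) assms(1)] assms(2)
  unfolding blocksA_def blocksC_def by blast

text \<open>One round of both inflations at least doubles the side of a legal window anchored at the
  origin.\<close>

lemma legal_windows: "\<exists>y. homogeneous usedC colC rowC y \<and> legal_on blocksC {0..<2 ^ N} {0..<2 ^ N} y"
proof (induction N)
  case 0
  \<comment> \<open>The doubly periodic repetition of \<open>hub\<close>. It is homogeneous
    everywhere, and legality is asked only of its block at the origin.\<close>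
  define y where "y = (\<lambda>(m :: int, n :: int). if even m then (if even n then 5 else 7) else (if even n then 9 else (10 :: nat)))"
  have "homogeneous usedC colC rowC y"
    unfolding homogeneous_def by (auto simp: y_def usedC_def colC_def colA_def rowC_def word2_def word3_def)
  moreover have "legal_on blocksC {0..<2 ^ 0} {0..<2 ^ 0} y"
  proof -
    have "{0..<2 ^ 0} = {0 :: int}" by auto
    then show ?thesis unfolding legal_on_def by (simp add: block_def y_def tblocks_def blocksC_def flip_table_def kept_def tabC_def)
  qed
  ultimately show ?case by blast
next
  case (Suc N)
  then obtain y where y: "homogeneous usedC colC rowC y" "legal_on blocksC {0..<2 ^ N} {0..<2 ^ N} y" by blast
  obtain a c where a: "slicing word2 (transposed a) (transposed y) c" "c 0 = 0" "homogeneous usedA colA rowA a"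
    by (rule inflate2[OF y(1)])
  obtain x d where x: "slicing word3 x a d" "d 0 = 0" "homogeneous usedC colC rowC x"
    by (rule inflate3[OF a(3)])
  have "legal_on blocksA {0..<2 ^ N} {0..<2 * 2 ^ N} a"
    by (rule legal_on_mono[OF legal_on_word2[OF a(1) y(2)] order_refl slicing_double[OF a(1,2) word_long(1)]])
  from legal_on_mono[OF legal_on_word3[OF x(1) this] slicing_double[OF x(1,2) word_long(2)] order_refl] x(3)
  show ?case by auto
qed

lemma legal_UNIV: "legal_on f UNIV UNIV x \<longleftrightarrow> x \<in> legal f"
  by (simp add: legal_on_def legal_def)

text \<open>Homogeneity is put among the closed conditions, as a comparison of each position with
  its projections to the axes, so that it survives the limit. The inflations that follow rely on
  it.\<close>

lemma blocksC_nonempty: "\<exists>x. homogeneous usedC colC rowC x \<and> x \<in> legal blocksC"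
proof -
  define P where "P = (\<lambda>(m, n) x. x (m, n) \<in> usedC \<and> colC (x (m, n)) = colC (x (m, 0)) \<and>
      rowC (x (m, n)) = rowC (x (0, n)) \<and> block x m n \<in> tblocks blocksC)"
  define S where "S p = {x. range x \<subseteq> usedC \<and> P p x}" for p
  have "\<exists>x. \<forall>p\<in>UNIV. x \<in> S p"
  proof (rule full_compact[of usedC])
    show "finite usedC" by (simp add: usedC_def)
    fix p :: "int \<times> int"
    obtain m n where p: "p = (m, n)" by (cases p)
    show "closedin (full usedC) (S p)"
    proof (rule closedin_fullI)
      show "range x \<subseteq> usedC" if "x \<in> S p" for x using that by (simp add: S_def)
      fix x assume x: "range x \<subseteq> usedC" and lim: "\<And>F. finite F \<Longrightarrow> \<exists>x'\<in>S p. \<forall>n\<in>F. x' n = x n"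
      obtain x' where x': "x' \<in> S p" "\<forall>n\<in>{(m, n), (m, 0), (0, n), (m + 1, n), (m, n + 1), (m + 1, n + 1)}. x' n = x n"
        using lim[of "{(m, n), (m, 0), (0, n), (m + 1, n), (m, n + 1), (m + 1, n + 1)}"] by blast
      then have "P p x' = P p x" by (simp add: P_def p block_def)
      then show "x \<in> S p" using x x'(1) by (simp add: S_def)
    qed
  next
    fix J :: "(int \<times> int) set" assume J: "finite J"
    define K where "K = Max ((\<lambda>(m, n). \<bar>m\<bar> + \<bar>n\<bar>) ` insert (0, 0) J)"
    have K: "\<bar>m\<bar> + \<bar>n\<bar> \<le> K" if "(m, n) \<in> J" for m n
      unfolding K_def
    proof (rule Max_ge)
      show "\<bar>m\<bar> + \<bar>n\<bar> \<in> (\<lambda>(m, n). \<bar>m\<bar> + \<bar>n\<bar>) ` insert (0, 0) J"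
        by (rule image_eqI[of _ _ "(m, n)"]) (simp_all add: that)
    qed (simp add: J)
    obtain N where N: "2 * K + 1 \<le> 2 ^ N"
    proof -
      have "2 * K + 1 \<le> int (2 ^ nat (2 * K + 1))"
        using less_exp[of "nat (2 * K + 1)"] by linarith
      then show ?thesis using that[of "nat (2 * K + 1)"] by simp
    qed
    obtain y where y: "homogeneous usedC colC rowC y" "legal_on blocksC {0..<2 ^ N} {0..<2 ^ N} y"
      using legal_windows by blast
    have y': "y (i, n) \<in> usedC" "colC (y (i, n)) = colC (y (i, 0))" "rowC (y (i, n)) = rowC (y (0, n))" for i n
      using y(1) unfolding homogeneous_def by blast+
    \<comment> \<open>Moves the origin into the interior of the legal window, which then contains
      \<open>J\<close>.\<close>
    define x where "x = shift (K, K) y"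
    have "x \<in> S p" if pJ: "p \<in> J" for p
    proof -
      obtain m n where p: "p = (m, n)" by (cases p)
      have b: "\<bar>m\<bar> \<le> K" "\<bar>n\<bar> \<le> K" using K[of m n] pJ p by auto
      then have "m + K \<in> {0..<2 ^ N}" "n + K \<in> {0..<2 ^ N}" using N by auto
      then have "block y (m + K) (n + K) \<in> tblocks blocksC" using y(2) unfolding legal_on_def by blast
      moreover have "block x m n = block y (m + K) (n + K)" by (simp add: block_def x_def shift_def algebra_simps)
      moreover have "range x \<subseteq> usedC" using y'(1) by (auto simp: x_def shift_def)
      moreover have "colC (x (m, n)) = colC (x (m, 0))" "rowC (x (m, n)) = rowC (x (0, n))"
        using y'(2)[of "m + K" "n + K"] y'(2)[of "m + K" K] y'(3)[of "m + K" "n + K"] y'(3)[of K "n + K"]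
        by (simp_all add: x_def shift_def)
      ultimately show ?thesis by (auto simp: S_def P_def p)
    qed
    then show "\<exists>x. \<forall>i\<in>J. x \<in> S i" by blast
  qed
  then obtain x where x: "x \<in> S p" for p by blast
  have "x (m, n) \<in> usedC \<and> colC (x (m, n)) = colC (x (m, 0)) \<and> rowC (x (m, n)) = rowC (x (0, n)) \<and> block x m n \<in> tblocks blocksC" for m n
    using x[of "(m, n)"] by (simp add: S_def P_def)
  then show ?thesis unfolding homogeneous_def legal_def by blast
qed

lemma tab6_nonempty: "\<exists>x. x \<in> legal tab6"
proof -
  obtain z where z: "homogeneous usedC colC rowC z" "z \<in> legal blocksC" using blocksC_nonempty by blast
  obtain a c where a: "slicing word2 (transposed a) (transposed z) c" "homogeneous usedA colA rowA a"
    using inflate2[OF z(1)] by metis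
  have full: "{m. \<exists>i\<in>UNIV. c i \<le> m \<and> m < c (i + 1)} = UNIV" if "\<And>i. c i < c (i + 1)" for c :: "int \<Rightarrow> int"
    using grid_cell[of c, OF that] by blast
  have "legal_on blocksC UNIV UNIV z" using z(2) by (simp add: legal_UNIV)
  from legal_on_word2[OF a(1) this] have la: "legal_on blocksA UNIV UNIV a"
    using full[of c] slicingD(1)[OF a(1)] by simp
  have a': "a (i, n) \<in> usedA" "colA (a (i, n)) = colA (a (i, 0))" for i n
    using a(2) unfolding homogeneous_def by blast+
  have len: "length (word1 (a (i, n))) = (if colA (a (i, 0)) = 2 then 3 else 5)" for i n
    using length_word1[OF a'(1)[of i n]] a'(2)[of i n] by simp
  have "length (word1 (a (i, n))) = length (word1 (a (i, 0)))" for i n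
    unfolding len ..
  moreover have "word1 (a (i, n)) \<noteq> []" for i n
    using len[of i n] by (auto split: if_splits)
  ultimately obtain x d where x: "slicing word1 x a d" "d 0 = 0" by (rule slicing_ex)
  have "legal_on tab6 {m. \<exists>i\<in>UNIV. d i \<le> m \<and> m < d (i + 1)} UNIV x"
    using legal_on_slicing[OF img1 kept_tab_letters(1) x(1)] la unfolding blocksA_def by blast
  then have "legal_on tab6 UNIV UNIV x" using full[of d] slicingD(1)[OF x(1)] by simp
  then show ?thesis by (auto simp: legal_UNIV)
qed

section \<open>The Wang shift of the tile set T5\<close>

lemma adjacency5:
  "list_all (\<lambda>(a, s). list_all (\<lambda>(b, t). (right_color s = left_color t) = (b \<in> set (h_succ a)) \<and>
     (top_color s = bottom_color t) = (b \<in> set (v_succ a))) (zip letters5 T5)) (zip letters5 T5)"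
  by (simp only: eval letters5_def T5_def zip_Cons_Cons zip.simps(1) h_succ_def v_succ_def right_color.simps left_color.simps
    top_color.simps bottom_color.simps cong: eval_cong)

lemma letters5_upt: "letters5 = [0..<29]" "length T5 = 29"
  by (auto simp: letters5_def T5_def upt_rec)

lemma adjacent5:
  assumes "a \<in> set letters5" "b \<in> set letters5"
  shows "(right_color (T5 ! a) = left_color (T5 ! b)) = (b \<in> set (h_succ a))"
    "(top_color (T5 ! a) = bottom_color (T5 ! b)) = (b \<in> set (v_succ a))"
proof -
  have z: "(a, T5 ! a) \<in> set (zip letters5 T5)" if "a \<in> set letters5" for a
  proof -
    have "a < 29" using that unfolding letters5_upt(1) by simp
    then show ?thesis using letters5_upt(2) unfolding letters5_upt(1) set_zip by (intro CollectI exI[of _ a]) simp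
  qed
  from bspec[OF bspec[OF adjacency5[unfolded list_all_iff] z[OF assms(1)], unfolded prod.case] z[OF assms(2)], unfolded prod.case]
  show "(right_color (T5 ! a) = left_color (T5 ! b)) = (b \<in> set (h_succ a))"
    "(top_color (T5 ! a) = bottom_color (T5 ! b)) = (b \<in> set (v_succ a))" by blast+
qed

lemma tiles_5: "tiles 5 = T5"
  by (simp add: tiles_def)

definition label :: "wang_tile \<Rightarrow> nat" where "label t = (SOME a. a \<in> set letters5 \<and> T5 ! a = t)"

lemma label: "t \<in> set T5 \<Longrightarrow> label t \<in> set letters5" "t \<in> set T5 \<Longrightarrow> T5 ! label t = t"
proof -
  assume "t \<in> set T5"
  then obtain a where "a < 29" "T5 ! a = t" using letters5_upt(2) by (auto simp: in_set_conv_nth)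
  then have "\<exists>a. a \<in> set letters5 \<and> T5 ! a = t" unfolding letters5_upt(1) by auto
  from someI_ex[OF this] show "label t \<in> set letters5" "T5 ! label t = t" by (simp_all add: label_def)
qed

definition shear :: "'a config \<Rightarrow> 'a config" where "shear x = (\<lambda>(m, n). x (m + n, n))"

lemma Omega_D:
  assumes "x \<in> Omega i"
  shows "x p \<in> set (tiles i)" "right_color (x (m, n)) = left_color (x (m + 1, n))"
    "top_color (x (m, n)) = bottom_color (x (m, n + 1))"
proof -
  show "x p \<in> set (tiles i)" using assms unfolding Omega_def wang_shift_def by blast
  have "right_color (x (m, n)) = left_color (x ((m, n) + (1, 0))) \<and> top_color (x (m, n)) = bottom_color (x ((m, n) + (0, 1)))"
    using assms unfolding Omega_def wang_shift_def by blast
  then show "right_color (x (m, n)) = left_color (x (m + 1, n))" "top_color (x (m, n)) = bottom_color (x (m, n + 1))"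
    by simp_all
qed

lemma Omega_I:
  assumes "\<And>m n. x (m, n) \<in> set (tiles i)" "\<And>m n. right_color (x (m, n)) = left_color (x (m + 1, n))"
    "\<And>m n. top_color (x (m, n)) = bottom_color (x (m, n + 1))"
  shows "x \<in> Omega i"
  unfolding Omega_def wang_shift_def using assms by auto

lemma label_legal:
  assumes x: "x \<in> Omega 5"
  shows "label \<circ> x \<in> legal (kept tab5)"
proof (rule prune[OF _ tab_letters(1) tab5_prunable], rule legalI)
  fix m n
  let ?y = "label \<circ> x"
  have l: "?y p \<in> set letters5" "T5 ! ?y p = x p" for p using label[OF Omega_D(1)[OF x, unfolded tiles_5]] by simp_all
  have h: "?y (i + 1, j) \<in> set (h_succ (?y (i, j)))" for i j
    using adjacent5(1)[OF l(1) l(1), of "(i, j)" "(i + 1, j)"] l(2) Omega_D(2)[OF x, of i j] by simp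
  have v: "?y (i, j + 1) \<in> set (v_succ (?y (i, j)))" for i j
    using adjacent5(2)[OF l(1) l(1), of "(i, j)" "(i, j + 1)"] l(2) Omega_D(3)[OF x, of i j] by simp
  have "if ?y (m + 1, n + 1) \<in> set (v_succ (?y (m + 1, n)))
      then (?y (m + 1, n), ?y (m, n + 1), ?y (m + 1, n + 1)) \<in> set (forget tab5 (?y (m, n))) else True"
    using tab5_complete l(1)[of "(m, n)"] h[of m n] v[of m n] h[of m "n + 1"] unfolding list_all_iff by blast
  then show "(?y (m + 1, n), ?y (m, n + 1), ?y (m + 1, n + 1)) \<in> set (forget tab5 (?y (m, n)))"
    using v[of "m + 1" n] by simp
qed

lemma shear_legal:
  assumes y: "y \<in> legal (kept tab5)"
  shows "shear y \<in> legal tab6"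
proof (rule legalI)
  fix m n
  have 1: "(y (m + n + 1, n), y (m + n, n + 1), y (m + n + 1, n + 1)) \<in> set (kept tab5 (y (m + n, n)))"
    and 2: "(y (m + n + 1 + 1, n), y (m + n + 1, n + 1), y (m + n + 1 + 1, n + 1)) \<in> set (kept tab5 (y (m + n + 1, n)))"
    by (rule legalD[OF y])+
  have "kept tab5 (y (m + n, n)) \<noteq> []" using 1 by auto
  then have "y (m + n, n) \<in> set letters5" by (rule tab_letters(1)[OF kept_letters(1)])
  from bspec[OF bspec[OF bspec[OF tab6_complete[unfolded list_all_iff] this] 1, unfolded prod.case] 2]
  have "(y (m + n + 1, n), y (m + n + 1, n + 1), y (m + n + 1 + 1, n + 1)) \<in> set (tab6 (y (m + n, n)))" by simp
  then show "(shear y (m + 1, n), shear y (m, n + 1), shear y (m + 1, n + 1)) \<in> set (tab6 (shear y (m, n)))"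
    by (simp add: shear_def algebra_simps)
qed

lemma desubst5:
  assumes "x \<in> Omega 5"
  obtains a z c d where "z \<in> legal blocksC" "slicing word1 (shear (label \<circ> x)) a c" "recognizable (shear (label \<circ> x)) a c"
    "slicing word2 (transposed a) (transposed z) d" "recognizable (transposed a) (transposed z) d"
proof -
  obtain a c where a: "a \<in> legal blocksA" "slicing word1 (shear (label \<circ> x)) a c" "recognizable (shear (label \<circ> x)) a c"
    using desubst1[OF shear_legal[OF label_legal[OF assms]]] .
  obtain z d where "z \<in> legal blocksC" "slicing word2 (transposed a) (transposed z) d" "recognizable (transposed a) (transposed z) d"
    using desubst2[OF a(1)] .
  then show ?thesis using that a by blast
qed

text \<open>The shear turns the square into a parallelogram. Its horizontal offset
  \<open>s - t\<close> lies strictly between \<open>- N\<close> and \<open>N\<close>, so a window of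
  width \<open>2 * N\<close> that starts at \<open>a - b - N\<close> contains it.\<close>

lemma occurs_shear:
  assumes "occurs (2 * N) N (shear x) (shear x')"
  shows "occurs N N x x'"
  unfolding occurs_def
proof (intro allI)
  fix a b
  obtain a' b' where eq: "\<forall>s\<in>{0..<2 * N}. \<forall>t\<in>{0..<N}. shear x (a - b - N + s, b + t) = shear x' (a' + s, b' + t)"
    using assms unfolding occurs_def by blast
  have "x (a + s, b + t) = x' (a' + N + b' + s, b' + t)" if "s \<in> {0..<N}" "t \<in> {0..<N}" for s t
  proof -
    have "N + s - t \<in> {0..<2 * N}" using that by auto
    from eq[rule_format, OF this that(2)] show ?thesis by (simp add: shear_def algebra_simps)
  qed
  then show "\<exists>a' b'. \<forall>s\<in>{0..<N}. \<forall>t\<in>{0..<N}. x (a + s, b + t) = x' (a' + s, b' + t)" by blast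
qed

lemma repetitive_Omega5: "repetitive (Omega 5)"
  unfolding repetitive_def
proof (intro ballI allI)
  fix x x' N assume x: "x \<in> Omega 5" and x': "x' \<in> Omega 5"
  show "occurs N N x x'"
  proof (cases "N \<le> 0")
    case True then show ?thesis using occurs_trivial by blast
  next
    case False
    obtain a z c d where z: "z \<in> legal blocksC" and a: "slicing word1 (shear (label \<circ> x)) a c" "slicing word2 (transposed a) (transposed z) d"
      using desubst5[OF x] by metis
    obtain a' z' c' d' where z': "z' \<in> legal blocksC" and a': "slicing word1 (shear (label \<circ> x')) a' c'" "slicing word2 (transposed a') (transposed z') d'"
      using desubst5[OF x'] by metis
    have pos: "0 < N" "0 < 2 * N" using False by auto
    have "occurs N (2 * N) (transposed z) (transposed z')" using occurs_blocksC[OF z z'] by (simp only: occurs_transposed)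
    then have "occurs N (2 * N) (transposed a) (transposed a')" by (rule occurs_slicing[OF a(2) a'(2)]) (rule slicing_cover[OF a(2) pos(1)])
    then have "occurs (2 * N) N a a'" by (simp only: occurs_transposed)
    then have "occurs (2 * N) N (shear (label \<circ> x)) (shear (label \<circ> x'))"
      by (rule occurs_slicing[OF a(1) a'(1)]) (rule slicing_cover[OF a(1) pos(2)])
    then have "occurs N N (label \<circ> x) (label \<circ> x')" by (rule occurs_shear)
    moreover have "label (x p) = label (x' q) \<longleftrightarrow> x p = x' q" for p q
      using label(2)[OF Omega_D(1)[OF x, unfolded tiles_5]] label(2)[OF Omega_D(1)[OF x', unfolded tiles_5]] by metis
    ultimately show ?thesis unfolding occurs_def by simp
  qed
qed

lemma period_Omega5:
  assumes x: "x \<in> Omega 5" and p: "shift p x = x"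
  shows "p = 0"
proof -
  obtain p1 p2 where pp: "p = (p1, p2)" by (cases p)
  obtain a z c d where z: "z \<in> legal blocksC" and "slicing word1 (shear (label \<circ> x)) a c"
    and a: "recognizable (shear (label \<circ> x)) a c" and "slicing word2 (transposed a) (transposed z) d" and d: "recognizable (transposed a) (transposed z) d"
    using desubst5[OF x] .
  have xp: "x (m + p1, n + p2) = x (m, n)" for m n using fun_cong[OF p, of "(m, n)"] by (simp add: shift_def pp)
  \<comment> \<open>In sheared coordinates the period \<open>(p1, p2)\<close> becomes
    \<open>(p1 - p2, p2)\<close>.\<close>
  have "shear (label \<circ> x) (m + (p1 - p2), n + p2) = shear (label \<circ> x) (m, n)" for m n
    using xp[of "m + n" n] by (simp add: shear_def algebra_simps)
  then have "shift (p1 - p2, p2) (shear (label \<circ> x)) = shear (label \<circ> x)" by (auto simp: shift_def)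
  then obtain q1 where q1: "\<And>i. c (i + q1) = c i + (p1 - p2)" "shift (q1, p2) a = a"
    using a unfolding recognizable_def by (metis fst_conv snd_conv)
  then have "shift (p2, q1) (transposed a) = transposed a" by (simp add: shift_transposed)
  then obtain q2 where q2: "\<And>i. d (i + q2) = d i + p2" "shift (q2, q1) (transposed z) = transposed z"
    using d unfolding recognizable_def by (metis fst_conv snd_conv)
  then have "transposed (shift (q1, q2) z) = transposed z" by (simp add: shift_transposed)
  then have "shift (q1, q2) z = z" by (metis transposed_transposed)
  then have "(q1, q2) = 0" by (rule period_blocksC[OF z])
  then have "p1 - p2 = 0" "p2 = 0" using q1(1)[of 0] q2(1)[of 0] by (simp_all add: zero_prod_def)
  then show ?thesis by (simp add: pp zero_prod_def)
qed

lemma nonempty_Omega5: "Omega 5 \<noteq> {}"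
proof -
  obtain y where y: "y \<in> legal tab6" using tab6_nonempty by blast
  define x where "x = (\<lambda>(m, n). T5 ! y (m - n, n))"
  have "tab6 (y (m, n)) \<noteq> []" for m n using legalD[OF y, of m n] by auto
  then have ly: "y p \<in> set letters5" for p using tab_letters(2)[of "y p"] by (cases p) blast
  have s: "y (m + 1, n) \<in> set (h_succ (y (m, n))) \<and> y (m, n + 1) \<in> set (v_succ (y (m + 1, n)))" for m n
    using bspec[OF bspec[OF tab6_sound[unfolded list_all_iff] ly[of "(m, n)"]] legalD[OF y, of m n]] by (simp split: if_splits)
  have "x p \<in> set T5" for p
  proof -
    have "T5 ! a \<in> set T5" if "a \<in> set letters5" for a using that letters5_upt(2) unfolding letters5_upt(1) by simp
    then show ?thesis using ly by (simp add: x_def split: prod.split)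
  qed
  moreover have "right_color (x (m, n)) = left_color (x (m + 1, n))" for m n
    using s[of "m - n" n] adjacent5(1)[OF ly ly, of "(m - n, n)" "(m - n + 1, n)"] by (simp add: x_def algebra_simps)
  \<comment> \<open>The tile above is the upper left neighbour in sheared coordinates, hence the
    block one column further left.\<close>
  moreover have "top_color (x (m, n)) = bottom_color (x (m, n + 1))" for m n
    using s[of "m - n - 1" n] adjacent5(2)[OF ly ly, of "(m - n, n)" "(m - n - 1, n + 1)"] by (simp add: x_def algebra_simps)
  ultimately have "x \<in> Omega 5" by (intro Omega_I) (simp_all only: tiles_5)
  then show ?thesis by blast
qed

section \<open>Juxtaposition\<close>

definition images :: "nat \<Rightarrow> (wang_tile \<times> wang_tile list) list" where
  "images i = zip (tiles (Suc i)) (map (map ((!) (tiles i))) (rule i))"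

text \<open>Tiles that occur in the images only as the lower half of a domino (for \<open>i < 3\<close>) or only as the upper half
  (for \<open>i = 3\<close>).\<close>

definition marked :: "nat \<Rightarrow> wang_tile list" where
  "marked i = map ((!) (tiles i))
     ([[0, 1], [8, 9, 10, 11, 12], [8, 9, 10, 11, 12, 13, 14, 15, 16, 17, 18, 19], [0, 1, 2, 3]] ! i)"

lemma image_shape:
  "\<forall>i\<in>{0,1,2,3}. \<forall>(t, w)\<in>set (images i). w \<noteq> [] \<and> length w \<le> 2 \<and> set w \<subseteq> set (tiles i) \<and>
     bottom_color t = bottom_color (hd w) \<and> top_color t = top_color (last w) \<and>
     (length w = 2 \<longrightarrow> top_color (w ! 0) = bottom_color (w ! 1))"
  by code_simp

lemma image_marked:
  "\<forall>i\<in>{0,1,2,3}. \<forall>(t, w)\<in>set (images i).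
     if i < 3 then last w \<notin> set (marked i) \<and> (length w = 2 \<longrightarrow> w ! 0 \<in> set (marked i))
     else hd w \<notin> set (marked i) \<and> (length w = 2 \<longrightarrow> w ! 1 \<in> set (marked i))"
  by code_simp

lemma image_distinct: "\<forall>i\<in>{0,1,2,3}. distinct (map snd (images i))"
  by code_simp

text \<open>Equal concatenated colours could a priori split in different ways. Here they come from
  equal lists of colours, so horizontally adjacent images match tile by tile.\<close>

lemma image_sides:
  "\<forall>i\<in>{0,1,2,3}. \<forall>(t, w)\<in>set (images i). \<forall>(t', w')\<in>set (images i).
     right_color t = left_color t' \<longrightarrow> map right_color w = map left_color w'"
  by code_simp

lemma less_4: "i < 4 \<Longrightarrow> i \<in> {0,1,2,3 :: nat}"
  by auto

lemma tile_image_images: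
  assumes i: "i < 4" and t: "t \<in> set (tiles (Suc i))"
  shows "(t, tile_image i t) \<in> set (images i)"
proof -
  let ?g = "map ((!) (tiles i))"
  have "length (tiles (Suc i)) = length (map ?g (rule i))"
    using length_rule less_4[OF i] by (metis length_map)
  then obtain v where v: "map_of (zip (tiles (Suc i)) (map ?g (rule i))) t = Some v"
    using t by (metis map_of_zip_is_Some)
  then show ?thesis using map_of_SomeD[OF v] by (simp add: tile_image_def images_def)
qed

lemma tile_image_shape:
  assumes i: "i < 4" and t: "t \<in> set (tiles (Suc i))"
  shows "tile_image i t \<noteq> []" "length (tile_image i t) \<le> 2" "set (tile_image i t) \<subseteq> set (tiles i)"
    "bottom_color (hd (tile_image i t)) = bottom_color t" "top_color (last (tile_image i t)) = top_color t"
    "length (tile_image i t) = 2 \<Longrightarrow> top_color (tile_image i t ! 0) = bottom_color (tile_image i t ! 1)"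
  using bspec[OF bspec[OF image_shape less_4[OF i]] tile_image_images[OF assms]] by auto

lemma tile_image_sides:
  assumes i: "i < 4" and t: "t \<in> set (tiles (Suc i))" "t' \<in> set (tiles (Suc i))" and "right_color t = left_color t'"
  shows "map right_color (tile_image i t) = map left_color (tile_image i t')"
proof -
  have "\<forall>(t', w')\<in>set (images i). right_color t = left_color t' \<longrightarrow> map right_color (tile_image i t) = map left_color w'"
    using bspec[OF bspec[OF image_sides less_4[OF i]] tile_image_images[OF i t(1)]] by simp
  from bspec[OF this tile_image_images[OF i t(2)]] assms(4) show ?thesis by simp
qed

lemma tile_image_inj:
  assumes i: "i < 4"
  shows "inj_on (tile_image i) (set (tiles (Suc i)))"
proof (rule inj_onI)
  fix t t' assume t: "t \<in> set (tiles (Suc i))" "t' \<in> set (tiles (Suc i))" and eq: "tile_image i t = tile_image i t'"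
  have "inj_on snd (set (images i))"
    using image_distinct less_4[OF i] by (simp only: distinct_map)
  from inj_onD[OF this _ tile_image_images[OF i t(1)] tile_image_images[OF i t(2)]] eq show "t = t'" by simp
qed

lemma omega_slicing:
  assumes "i < 4" "y \<in> Omega (Suc i)"
  shows "slicing (tile_image i) (transposed (omega i y)) (transposed y) (base_height (tile_image i) y 0)"
  unfolding omega_def
  by (rule juxtapose_slicing) (rule row_height[OF assms], rule tile_image_shape(1)[OF assms(1) Omega_D(1)[OF assms(2)]])

lemma image_slicing_recognizable:
  assumes i: "i < 4" and x: "slicing (tile_image i) x y c" and y: "\<And>p. y p \<in> set (tiles (Suc i))"
  shows "recognizable x y c"
proof (rule slicing_recognizable[OF x])
  show "inj_on (tile_image i) (range y)"
    by (rule inj_on_subset[OF tile_image_inj[OF i]]) (use y in blast)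
  \<comment> \<open>For \<open>i < 3\<close> the marked tiles are lower halves, so an unmarked tile
    below signals a cut. For \<open>i = 3\<close> they are upper halves, and the tile above
    decides.\<close>
  define D where "D a b = (if i < 3 then a \<notin> set (marked i) else b \<notin> set (marked i))" for a b
  have M: "if i < 3 then last w \<notin> set (marked i) \<and> (length w = 2 \<longrightarrow> w ! 0 \<in> set (marked i))
     else hd w \<notin> set (marked i) \<and> (length w = 2 \<longrightarrow> w ! 1 \<in> set (marked i))" if "w = tile_image i (y p)" for w p
    using bspec[OF bspec[OF image_marked less_4[OF i]] tile_image_images[OF i y[of p]]] unfolding that prod.case .
  show "D (x (m - 1, n)) (x (m, n)) \<longleftrightarrow> m \<in> range c" for m n
  proof -
    have sm: "strict_mono c" using grid_mono slicingD(1)[OF x] by blast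
    obtain j where j: "c j \<le> m" "m < c (j + 1)" using grid_cell[of c m] slicingD(1)[OF x] by blast
    let ?w = "tile_image i (y (j, n))"
    have w: "?w \<noteq> []" "length ?w \<le> 2" using tile_image_shape(1,2)[OF i y] by blast+
    show ?thesis
    proof (cases "m = c j")
      case True
      let ?v = "tile_image i (y (j - 1, n))"
      have v: "?v \<noteq> []" using tile_image_shape(1)[OF i y] by blast
      have cj: "c j = c (j - 1) + int (length ?v)" using slicingD(2)[OF x, of "j - 1" n] by simp
      have "x (m, n) = hd ?w" using slicingD(3)[OF x, of 0 j n] w True by (simp add: hd_conv_nth)
      moreover have "x (m - 1, n) = last ?v"
      proof -
        have "m - 1 = c (j - 1) + int (length ?v - 1)" using v True cj by (simp add: of_nat_diff Suc_leI)
        then show ?thesis using slicingD(3)[OF x, of "length ?v - 1" "j - 1" n] v by (simp add: last_conv_nth)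
      qed
      ultimately have "D (x (m - 1, n)) (x (m, n))"
        using M[OF refl, of "(j, n)"] M[OF refl, of "(j - 1, n)"] by (auto simp: D_def split: if_splits)
      then show ?thesis using True by blast
    next
      case False
      then have m: "m = c j + 1" "length ?w = 2" using j slicingD(2)[OF x, of j n] w(2) by linarith+
      have "x (m - 1, n) = ?w ! 0" "x (m, n) = ?w ! 1"
        using slicingD(3)[OF x, of 0 j n] slicingD(3)[OF x, of 1 j n] m by simp_all
      then have "\<not> D (x (m - 1, n)) (x (m, n))"
        using M[OF refl, of "(j, n)"] m(2) by (auto simp: D_def split: if_splits)
      moreover have "m \<noteq> c k" for k
        using False j strict_mono_less[OF sm, of j k] strict_mono_less[OF sm, of k "j + 1"] by force
      ultimately show ?thesis by blast
    qed
  qed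
qed

text \<open>Vertical matching holds inside a domino by the choice of the rules. Across a cut it is
  inherited from \<open>y\<close>, because an image keeps the outer bottom and top colours of its
  tile.\<close>

lemma image_slicing_Omega:
  assumes i: "i < 4" and x: "slicing (tile_image i) (transposed x) (transposed y) c" and y: "y \<in> Omega (Suc i)"
  shows "x \<in> Omega i"
proof (rule Omega_I)
  fix m n
  let ?w = "\<lambda>m j. tile_image i (y (m, j))"
  obtain j where j: "c j \<le> n" "n < c (j + 1)" using grid_cell[of c n] slicingD(1)[OF x] by blast
  define s where "s = nat (n - c j)"
  have xs: "x (m, n) = ?w m j ! s" "s < length (?w m j)" for m
    using slicing_at[OF x j, of m] by (simp_all add: s_def)
  note sh = tile_image_shape[OF i Omega_D(1)[OF y]]
  show "x (m, n) \<in> set (tiles i)" using xs[of m] sh(3)[of "(m, j)"] nth_mem by fastforce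
  have "map right_color (?w m j) = map left_color (?w (m + 1) j)"
    by (rule tile_image_sides[OF i Omega_D(1)[OF y] Omega_D(1)[OF y] Omega_D(2)[OF y]])
  then show "right_color (x (m, n)) = left_color (x (m + 1, n))"
    using xs[of m] xs[of "m + 1"] by (metis nth_map)
  have len: "c (j + 1) = c j + int (length (?w m j))" using slicingD(2)[OF x, of j m] by simp
  show "top_color (x (m, n)) = bottom_color (x (m, n + 1))"
  proof (cases "n + 1 < c (j + 1)")
    case True
    then have s: "s = 0" "length (?w m j) = 2" using sh(2)[of "(m, j)"] len j by (auto simp: s_def)
    then have n: "n = c j" using j by (simp add: s_def)
    have "x (m, n + 1) = ?w m j ! 1" using slicingD(3)[OF x, of 1 j m] s n by simp
    then show ?thesis using xs(1)[of m] sh(6)[OF s(2)] s(1) by simp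
  next
    case False
    then have n: "n + 1 = c (j + 1)" using j by simp
    then have "s = length (?w m j) - 1" using len j by (simp add: s_def)
    then have "x (m, n) = last (?w m j)" using xs[of m] sh(1)[of "(m, j)"] by (simp add: last_conv_nth)
    moreover have "x (m, n + 1) = hd (?w m (j + 1))"
      using slicingD(3)[OF x, of 0 "j + 1" m] sh(1)[of "(m, j + 1)"] n by (simp add: hd_conv_nth)
    ultimately show ?thesis using sh(4)[of "(m, j + 1)"] sh(5)[of "(m, j)"] Omega_D(3)[OF y, of m j] by simp
  qed
qed

section \<open>Transport of the invariant through one juxtaposition\<close>

lemma closedin_shift:
  assumes A: "finite A" and X: "closedin (full A) X"
  shows "closedin (full A) (shift p ` X)"
proof (rule closedin_local_image[OF A X])
  show "range (shift p x) \<subseteq> A" if "x \<in> X" for x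
    using closedin_subset[OF X] that unfolding topspace_full by (auto simp: shift_def)
  show "\<exists>F. finite F \<and> (\<forall>x\<in>X. \<forall>x'\<in>X. (\<forall>k\<in>F. x k = x' k) \<longrightarrow> shift p x n = shift p x' n)" for n
    by (intro exI[of _ "{n + p}"]) (simp add: shift_def)
qed

text \<open>Repetitivity stands in for minimality, since it passes through slicings window by
  window. Minimality is recovered on every level by \<open>repetitive_minimal\<close>.\<close>

definition aperiodic_repetitive :: "nat \<Rightarrow> wang_tile config set \<Rightarrow> bool" where
  "aperiodic_repetitive i X \<longleftrightarrow> X \<subseteq> Omega i \<and> subshift (set (tiles i)) X \<and> aperiodic X \<and> repetitive X"

lemma aperiodic_repetitive_omega:
  assumes i: "i < 4" and X: "aperiodic_repetitive (Suc i) X"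
  shows "aperiodic_repetitive i (shift_closure (omega i ` X))"
proof -
  let ?Z = "shift_closure (omega i ` X)" and ?w = "tile_image i"
  have XO: "y \<in> Omega (Suc i)" if "y \<in> X" for y using X that unfolding aperiodic_repetitive_def by blast
  have Xcl: "closedin (full (set (tiles (Suc i)))) X" and Xsh: "shift n ` X = X" for n
    using X unfolding aperiodic_repetitive_def subshift_def by blast+
  have Xap: "aperiodic X" and Xrep: "repetitive X" using X unfolding aperiodic_repetitive_def by - (elim conjE, assumption)+
  have Xne: "X \<noteq> {}" using Xap unfolding aperiodic_def by (rule conjunct1)
  have Xs: "shift n y \<in> X" if "y \<in> X" for n y using Xsh[of n] that by blast
  \<comment> \<open>The horizontal part of a shift is absorbed by the tiling of \<open>X\<close>,
    while the vertical part only moves the cuts.\<close>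
  have decomp: "\<exists>y\<in>X. \<exists>c. slicing ?w (transposed x) (transposed y) c \<and> recognizable (transposed x) (transposed y) c" if xZ: "x \<in> ?Z" for x
  proof -
    obtain a b y where y: "y \<in> X" and x: "x = shift (a, b) (omega i y)"
      using xZ unfolding shift_closure_def by force
    let ?y = "shift (a, 0) y"
    have t: "transposed x = shift (b, a) (transposed (omega i y))" "transposed ?y = shift (0, a) (transposed y)"
      by (simp_all add: x shift_transposed)
    have c: "slicing ?w (transposed x) (transposed ?y) (\<lambda>j. base_height ?w y 0 j - b)"
      unfolding t by (rule slicing_shift[OF omega_slicing[OF i XO[OF y]]])
    moreover have "recognizable (transposed x) (transposed ?y) (\<lambda>j. base_height ?w y 0 j - b)"
      by (rule image_slicing_recognizable[OF i c]) (use Omega_D(1)[OF XO[OF Xs[OF y]]] in \<open>simp add: transposed_def split: prod.split\<close>)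
    ultimately show ?thesis using Xs[OF y] by blast
  qed
  have sub: "?Z \<subseteq> Omega i" using decomp image_slicing_Omega[OF i] XO by blast
  have shZ: "shift n ` ?Z = ?Z" for n
  proof -
    have 1: "shift n x \<in> ?Z" if xZ: "x \<in> ?Z" for n x
    proof -
      obtain k u where "u \<in> omega i ` X" "x = shift k u" using xZ unfolding shift_closure_def by blast
      then have "shift n x = shift (n + k) u" "u \<in> omega i ` X" by (simp_all add: shift_shift)
      then show ?thesis unfolding shift_closure_def by blast
    qed
    have "x \<in> shift n ` ?Z" if "x \<in> ?Z" for x
    proof (rule image_eqI)
      show "x = shift n (shift (- n) x)" by (simp add: shift_shift)
      show "shift (- n) x \<in> ?Z" by (rule 1[OF that])
    qed
    then show ?thesis using 1 by blast
  qed
  have clo: "closedin (full (set (tiles i))) (omega i ` X)"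
  proof (rule closedin_local_image[OF finite_set Xcl])
    show "range (omega i y) \<subseteq> set (tiles i)" if "y \<in> X" for y
    proof -
      have "omega i y \<in> Omega i" by (rule image_slicing_Omega[OF i omega_slicing[OF i XO[OF that]] XO[OF that]])
      then show ?thesis using Omega_D(1) by blast
    qed
    fix p :: "int \<times> int"
    obtain m n where p: "p = (m, n)" by (cases p)
    \<comment> \<open>The cut 0 lies at 0, so \<open>slicing_local\<close> asks for the letters of
      column \<open>m\<close> with index at most \<open>\<bar>n\<bar> + 1\<close> in absolute
      value.\<close>
    define F where "F = (\<lambda>j. (m, j)) ` {- (\<bar>n\<bar> + 1)..\<bar>n\<bar> + 1}"
    have "omega i y p = omega i y' p" if y: "y \<in> X" "y' \<in> X" "\<forall>k\<in>F. y k = y' k" for y y'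
    proof -
      have "transposed (omega i y) (n, m) = transposed (omega i y') (n, m)"
      proof (rule slicing_local[OF omega_slicing[OF i XO[OF y(1)]] omega_slicing[OF i XO[OF y(2)]]])
        show "base_height ?w y 0 0 = base_height ?w y' 0 0" by (simp add: base_height_def)
        fix j assume "\<bar>j\<bar> \<le> \<bar>n\<bar> + \<bar>base_height ?w y 0 0\<bar> + 1"
        then have "j \<in> {- (\<bar>n\<bar> + 1)..\<bar>n\<bar> + 1}" by (simp add: base_height_def abs_le_iff)
        then have "(m, j) \<in> F" unfolding F_def by (rule imageI)
        then show "transposed y (j, m) = transposed y' (j, m)" using y(3) by simp
      qed
      then show ?thesis by (simp add: p)
    qed
    moreover have "finite F" by (simp add: F_def)
    ultimately show "\<exists>F. finite F \<and> (\<forall>x\<in>X. \<forall>x'\<in>X. (\<forall>k\<in>F. x k = x' k) \<longrightarrow> omega i x p = omega i x' p)"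
      by blast
  qed
  \<comment> \<open>A union over all shifts need not be closed. Shifts from cut to cut are absorbed
    by \<open>X\<close>, and images have height at most 2, so two closed sets exhaust the
    union.\<close>
  have Z: "?Z = omega i ` X \<union> shift (0, 1) ` omega i ` X"
  proof
    show "omega i ` X \<union> shift (0, 1) ` omega i ` X \<subseteq> ?Z"
      unfolding shift_closure_def by (metis (no_types, lifting) UN_upper Un_least UNIV_I image_cong image_ident shift_0(1))
    show "?Z \<subseteq> omega i ` X \<union> shift (0, 1) ` omega i ` X"
    proof
      fix x assume "x \<in> ?Z"
      then obtain a b y where y: "y \<in> X" and x: "x = shift (a, b) (omega i y)"
        unfolding shift_closure_def by force
      define c where "c = base_height ?w y 0"
      have cy: "slicing ?w (transposed (omega i y)) (transposed y) c" unfolding c_def by (rule omega_slicing[OF i XO[OF y]])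
      obtain j where j: "c j \<le> b" "b < c (j + 1)" using grid_cell[of c b] slicingD(1)[OF cy] by blast
      have "c (j + 1) \<le> c j + 2"
        using slicingD(2)[OF cy, of j 0] tile_image_shape(2)[OF i Omega_D(1)[OF XO[OF y]], of "(0, j)"] by simp
      then have b: "b = c j \<or> b = c j + 1" using j by linarith
      let ?y = "shift (a, j) y"
      \<comment> \<open>Both sides are sliced by the same tiling with the cut 0 at 0, which
        determines them by \<open>slicing_local\<close>.\<close>
      have "shift (a, c j) (omega i y) = omega i ?y"
      proof -
        have 1: "slicing ?w (transposed (omega i ?y)) (transposed ?y) (base_height ?w ?y 0)"
          by (rule omega_slicing[OF i XO[OF Xs[OF y]]])
        have "slicing ?w (shift (c j, a) (transposed (omega i y))) (shift (j, 0) (shift (0, a) (transposed y))) (\<lambda>k. c (k + j) - c j)"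
          by (rule slicing_reindex[OF slicing_shift[OF cy]])
        then have 2: "slicing ?w (transposed (shift (a, c j) (omega i y))) (transposed ?y) (\<lambda>k. c (k + j) - c j)"
          by (simp add: shift_transposed shift_shift)
        have "transposed (shift (a, c j) (omega i y)) (n, m) = transposed (omega i ?y) (n, m)" for m n
          by (rule slicing_local[OF 2 1]) (simp_all add: base_height_def)
        then show ?thesis by (auto simp: transposed_def)
      qed
      moreover have "x = shift (0, b - c j) (shift (a, c j) (omega i y))" by (simp add: x shift_shift)
      ultimately have x: "x = shift (0, b - c j) (omega i ?y)" by simp
      have "?y \<in> X" by (rule Xs[OF y])
      then show "x \<in> omega i ` X \<union> shift (0, 1) ` omega i ` X" using b x by auto
    qed
  qed
  have "closedin (full (set (tiles i))) ?Z"
    unfolding Z by (intro closedin_Un clo closedin_shift finite_set)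
  then have "subshift (set (tiles i)) ?Z" using shZ unfolding subshift_def by blast
  moreover have "aperiodic ?Z"
    unfolding aperiodic_def
  proof (intro conjI ballI allI impI)
    show "?Z \<noteq> {}" using Xne unfolding Z by blast
    fix x and p :: "int \<times> int" assume x: "x \<in> ?Z" and p: "p \<noteq> 0"
    show "shift p x \<noteq> x"
    proof
      assume per: "shift p x = x"
      obtain y c where y: "y \<in> X" and c: "recognizable (transposed x) (transposed y) c" using decomp[OF x] by blast
      obtain p1 p2 where pp: "p = (p1, p2)" by (cases p)
      have "shift (p2, p1) (transposed x) = transposed x" using per by (simp add: shift_transposed pp)
      then obtain q where q: "\<And>i. c (i + q) = c i + p2" "shift (q, p1) (transposed y) = transposed y"
        using c unfolding recognizable_def by (metis fst_conv snd_conv)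
      then have "transposed (shift (p1, q) y) = transposed y" by (simp add: shift_transposed)
      then have "shift (p1, q) y = y" by (metis transposed_transposed)
      then have "(p1, q) = 0" using Xap y unfolding aperiodic_def by blast
      then show False using q(1)[of 0] p by (simp add: pp zero_prod_def)
    qed
  qed
  moreover have "repetitive ?Z"
    unfolding repetitive_def
  proof (intro ballI allI)
    fix x x' N assume x: "x \<in> ?Z" and x': "x' \<in> ?Z"
    obtain y c where y: "y \<in> X" and c: "slicing ?w (transposed x) (transposed y) c" using decomp[OF x] by blast
    obtain y' c' where y': "y' \<in> X" and c': "slicing ?w (transposed x') (transposed y') c'" using decomp[OF x'] by blast
    show "occurs N N x x'"
    proof (cases "N \<le> 0")
      case True then show ?thesis using occurs_trivial by blast
    next
      case False
      have "occurs N N y y'" using Xrep y y' unfolding repetitive_def by blast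
      then have "occurs N N (transposed y) (transposed y')" by (simp only: occurs_transposed)
      then have "occurs N N (transposed x) (transposed x')"
        by (rule occurs_slicing[OF c c']) (rule slicing_cover[OF c], use False in simp)
      then show ?thesis by (simp only: occurs_transposed)
    qed
  qed
  ultimately show ?thesis using sub unfolding aperiodic_repetitive_def by blast
qed

section \<open>The recolouring\<close>

text \<open>The two tiles identified by \<open>jmath_tile\<close> differ in the bottom colour, which is the top colour of the
  tile below, and top colours survive.\<close>

lemma jmath_top:
  "\<forall>t\<in>set (tiles 5). \<forall>t'\<in>set (tiles 5). jmath_tile t = jmath_tile t' \<longrightarrow>
     top_color t = top_color t' \<and> (bottom_color t = bottom_color t' \<longrightarrow> t = t')"
  by code_simp

lemma jmath_inj: "inj_on jmath (Omega 5)"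
proof (rule inj_onI)
  fix x x' assume x: "x \<in> Omega 5" and x': "x' \<in> Omega 5" and eq: "jmath x = jmath x'"
  have e: "jmath_tile (x p) = jmath_tile (x' p)" for p using fun_cong[OF eq, of p] by (simp add: jmath_def)
  have t: "top_color (x p) = top_color (x' p) \<and> (bottom_color (x p) = bottom_color (x' p) \<longrightarrow> x p = x' p)" for p
    using jmath_top Omega_D(1)[OF x, of p] Omega_D(1)[OF x', of p] e[of p] by blast
  have "x (m, n) = x' (m, n)" for m n
    using t[of "(m, n)"] t[of "(m, n - 1)"] Omega_D(3)[OF x, of m "n - 1"] Omega_D(3)[OF x', of m "n - 1"] by simp
  then show "x = x'" by auto
qed

lemma shift_Omega: "x \<in> Omega i \<Longrightarrow> shift p x \<in> Omega i"
  by (cases p, rule Omega_I) (auto simp: shift_def Omega_D algebra_simps)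

lemma closedin_Omega: "closedin (full (set (tiles i))) (Omega i)"
proof (rule closedin_fullI)
  show "range x \<subseteq> set (tiles i)" if "x \<in> Omega i" for x using Omega_D(1)[OF that] by blast
  fix x assume x: "range x \<subseteq> set (tiles i)" and lim: "\<And>F. finite F \<Longrightarrow> \<exists>x'\<in>Omega i. \<forall>n\<in>F. x' n = x n"
  have "x (m, n) \<in> set (tiles i) \<and> right_color (x (m, n)) = left_color (x (m + 1, n)) \<and>
      top_color (x (m, n)) = bottom_color (x (m, n + 1))" for m n
  proof -
    obtain x' where x': "x' \<in> Omega i" "\<forall>k\<in>{(m, n), (m + 1, n), (m, n + 1)}. x' k = x k"
      using lim[of "{(m, n), (m + 1, n), (m, n + 1)}"] by blast
    then show ?thesis using Omega_D(1)[OF x'(1), of "(m, n)"] Omega_D(2,3)[OF x'(1), of m n] by simp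
  qed
  then show "x \<in> Omega i" by (intro Omega_I) blast+
qed

lemma aperiodic_repetitive_jmath: "aperiodic_repetitive 4 (jmath ` Omega 5)"
proof -
  have sh: "shift p (jmath x) = jmath (shift p x)" for p x
    by (auto simp: shift_def jmath_def)
  have O4: "jmath x \<in> Omega 4" if x: "x \<in> Omega 5" for x
  proof (rule Omega_I)
    fix m n
    have side: "right_color (jmath_tile t) = right_color t" "left_color (jmath_tile t) = left_color t"
      "top_color (jmath_tile t) = recolor (top_color t)" "bottom_color (jmath_tile t) = recolor (bottom_color t)" for t
      by (cases t; simp)+
    show "jmath x (m, n) \<in> set (tiles 4)"
      using Omega_D(1)[OF x, of "(m, n)"] jmath_tile_image unfolding jmath_def by auto
    show "right_color (jmath x (m, n)) = left_color (jmath x (m + 1, n))"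
      "top_color (jmath x (m, n)) = bottom_color (jmath x (m, n + 1))"
      using Omega_D(2,3)[OF x, of m n] by (simp_all add: jmath_def side)
  qed
  have "closedin (full (set (tiles 4))) (jmath ` Omega 5)"
  proof (rule closedin_local_image[OF finite_set closedin_Omega])
    show "range (jmath x) \<subseteq> set (tiles 4)" if "x \<in> Omega 5" for x using Omega_D(1)[OF O4[OF that]] by blast
    show "\<exists>F. finite F \<and> (\<forall>x\<in>Omega 5. \<forall>x'\<in>Omega 5. (\<forall>k\<in>F. x k = x' k) \<longrightarrow> jmath x n = jmath x' n)" for n
      by (intro exI[of _ "{n}"]) (simp add: jmath_def)
  qed
  moreover have "shift p ` jmath ` Omega 5 = jmath ` Omega 5" for p
  proof -
    have "jmath x = shift p (jmath (shift (- p) x))" for x by (simp add: sh shift_shift)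
    then have "jmath ` Omega 5 \<subseteq> shift p ` jmath ` Omega 5" using shift_Omega by blast
    moreover have "shift p ` jmath ` Omega 5 \<subseteq> jmath ` Omega 5"
    proof
      fix y assume "y \<in> shift p ` jmath ` Omega 5"
      then obtain x where "x \<in> Omega 5" "y = jmath (shift p x)" using sh by blast
      then show "y \<in> jmath ` Omega 5" using shift_Omega by blast
    qed
    ultimately show ?thesis by blast
  qed
  ultimately have "subshift (set (tiles 4)) (jmath ` Omega 5)" unfolding subshift_def by blast
  moreover have "aperiodic (jmath ` Omega 5)"
    unfolding aperiodic_def
  proof (intro conjI ballI allI impI)
    show "jmath ` Omega 5 \<noteq> {}" using nonempty_Omega5 by blast
    fix y and p :: "int \<times> int" assume y: "y \<in> jmath ` Omega 5" and p: "p \<noteq> 0"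
    show "shift p y \<noteq> y"
    proof
      assume "shift p y = y"
      moreover obtain x where x: "x \<in> Omega 5" "y = jmath x" using y by blast
      ultimately have "jmath (shift p x) = jmath x" by (simp add: sh)
      \<comment> \<open>Injectivity lifts a period of the recoloured tiling to the tiling
        itself.\<close>
      then have "shift p x = x" using inj_onD[OF jmath_inj] shift_Omega[OF x(1)] x(1) by blast
      then show False using period_Omega5[OF x(1)] p by blast
    qed
  qed
  moreover have "repetitive (jmath ` Omega 5)"
    unfolding repetitive_def
  proof (intro ballI allI)
    fix y y' N assume "y \<in> jmath ` Omega 5" "y' \<in> jmath ` Omega 5"
    then obtain x x' where x: "x \<in> Omega 5" "x' \<in> Omega 5" "y = jmath x" "y' = jmath x'" by blast
    then have "occurs N N x x'" using repetitive_Omega5 unfolding repetitive_def by blast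
    then show "occurs N N y y'" unfolding occurs_def x(3,4) jmath_def comp_def by metis
  qed
  ultimately show ?thesis using O4 unfolding aperiodic_repetitive_def by blast
qed

theorem corollary5:
  fixes X :: "nat \<Rightarrow> wang_tile config set"
  assumes "X 4 = jmath ` Omega 5"
    and "X 3 = shift_closure (omega 3 ` X 4)"
    and "X 2 = shift_closure (omega 2 ` X 3)"
    and "X 1 = shift_closure (omega 1 ` X 2)"
    and "X 0 = shift_closure (omega 0 ` X 1)"
  shows "\<forall>i\<le>4. X i \<subseteq> Omega i \<and> subshift (set (tiles i)) (X i) \<and>
           aperiodic (X i) \<and> minimal_subshift (set (tiles i)) (X i)"
proof -
  have g4: "aperiodic_repetitive 4 (X 4)" unfolding assms(1) by (rule aperiodic_repetitive_jmath)
  have g3: "aperiodic_repetitive 3 (X 3)" unfolding assms(2) by (rule aperiodic_repetitive_omega) (use g4 in simp_all)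
  have g2: "aperiodic_repetitive 2 (X 2)" unfolding assms(3) by (rule aperiodic_repetitive_omega) (use g3 in \<open>simp_all add: numeral_3_eq_3\<close>)
  have g1: "aperiodic_repetitive 1 (X 1)" unfolding assms(4) by (rule aperiodic_repetitive_omega) (use g2 in \<open>simp_all add: numeral_2_eq_2\<close>)
  have g0: "aperiodic_repetitive 0 (X 0)" unfolding assms(5) by (rule aperiodic_repetitive_omega) (use g1 in simp_all)
  have "aperiodic_repetitive i (X i)" if "i \<le> 4" for i
  proof -
    have "i = 0 \<or> i = 1 \<or> i = 2 \<or> i = 3 \<or> i = 4" using that by linarith
    then show ?thesis using g0 g1 g2 g3 g4 by blast
  qed
  then show ?thesis using repetitive_minimal unfolding aperiodic_repetitive_def by blast
qed

end
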